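(* Let $f:\mathbb{R}\to\mathbb{R}$ be a Lipschitz continuous, 1-periodic function which is exactly 1-periodic, in the sense that $f(\cdot-\theta)\neq f(\cdot-\theta^* )$ on a set of positive Lebesgue measure whenever $\theta\neq\theta^*\bmod 1$. Let $Z_1,\dots,Z_n$ be iid with an even density $\phi$ and distribution function $\Phi$, and observe $Y_i=f(x_i-\theta^* )+Z_i$, $i=1,\dots,n$, where $x_i:=i/n$. Let $\Phi_2(t):=\int_{-\infty}^\infty\Phi(t+z)\phi(z)\,dz$ and $$M(\theta):=\int_0^1\!\!\int_0^1 \Phi_2\big(f(x_0)-f(x)\big)\, f(x_0+\theta^*-\theta)\,dx\,dx_0,$$ and assume that $\theta^*$ is the unique maximum point of $M$ modulo 1. Let $R_i$ be the rank of $Y_i$ among $Y_1,\dots,Y_n$ and let $\hat\theta_n$ be a maximizer over $\theta$ of $\widehat M_n(\theta):=\frac1n\sum_{i=1}^n\frac{R_i}{n}f(x_i-\theta)$. Then $\hat\theta_n$ is $\sqrt n$-consistent: $\sqrt n\, d(\hat\theta_n,\theta^* )$ is bounded in probability, where $d$ denotes the distance modulo 1 (distance in $\mathbb{R}/\mathbb{Z}$).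
   Context: $\hat\theta_n$ is the rank-based (R-)estimator of the shift; the shift is identified only modulo 1. *)

theory Defs
  imports "HOL-Probability.Probability"
begin

definition dist_mod1 :: "real \<Rightarrow> real \<Rightarrow> real" where
  "dist_mod1 a b = (INF k::int. \<bar>a - b - real_of_int k\<bar>)"

definition Phi_of :: "(real \<Rightarrow> real) \<Rightarrow> real \<Rightarrow> real" where
  "Phi_of \<phi> t = (LINT z:{..t}|lborel. \<phi> z)"

definition Phi2_of :: "(real \<Rightarrow> real) \<Rightarrow> real \<Rightarrow> real" where
  "Phi2_of \<phi> t = (LINT z|lborel. Phi_of \<phi> (t + z) * \<phi> z)"

definition Mpop :: "(real \<Rightarrow> real) \<Rightarrow> (real \<Rightarrow> real) \<Rightarrow> real \<Rightarrow> real \<Rightarrow> real" where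
  "Mpop f \<phi> \<theta>s \<theta> =
     (LINT x0:{0..1}|lborel. (LINT x:{0..1}|lborel.
        Phi2_of \<phi> (f x0 - f x) * f (x0 + \<theta>s - \<theta>)))"

definition rank_of :: "(nat \<Rightarrow> real) \<Rightarrow> nat \<Rightarrow> nat \<Rightarrow> nat" where
  "rank_of Y n i = card {j \<in> {1..n}. Y j \<le> Y i}"

definition Mhat :: "(real \<Rightarrow> real) \<Rightarrow> nat \<Rightarrow> (nat \<Rightarrow> real) \<Rightarrow> real \<Rightarrow> real" where
  "Mhat f n Y \<theta> =
     (1 / real n) * (\<Sum>i = 1..n. (real (rank_of Y n i) / real n) * f (real i / real n - \<theta>))"

end

theory Submission
  imports Defs
begin

text \<open>
  Write \<open>g = f(\<cdot> - \<theta>s)\<close>, \<open>a\<^sub>i = g(i/n)\<close> and let \<open>F\<close> be the distribution function of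
  \<open>Z\<^sub>j - Z\<^sub>i\<close>, \<open>i \<noteq> j\<close>. Up to an error \<open>O(1/n)\<close> the estimator may be rounded to the grid
  \<open>\<theta>s + k/n\<close>, where shifting is a cyclic permutation of the sample points. Put
  \<open>D\<^sub>i(k) = a\<^sub>i - a\<^sub>i\<^sub>-\<^sub>k\<close>.

  Drift: the mean of \<open>R\<^sub>i\<close> is a monotone function of \<open>a\<^sub>i\<close>, so the rearrangement inequality makes the
  mean of \<open>n\<^sup>-\<^sup>1 \<Sum> R\<^sub>i D\<^sub>i(k)\<close> nonnegative. By Steinhaus' theorem \<open>F\<close> grows at least linearly near \<open>0\<close>,
  whatever the density, and the inequality improves to a lower bound of order \<open>\<Sum> D\<^sub>i(k)\<^sup>2\<close>, which
  is at least of order \<open>k\<^sup>2/n\<close> for \<open>k \<le> n/2\<close>. No smoothness of \<open>F\<close> is involved.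

  Noise: let \<open>W\<^sub>k\<close> be the centred version of \<open>n\<^sup>-\<^sup>2 \<Sum> R\<^sub>i D\<^sub>i(k)\<close>. Its increments in \<open>k\<close> have second moment
  \<open>O(n\<^sup>-\<^sup>3)\<close>, since comparisons of disjoint pairs are independent. A weighted Cauchy--Schwarz inequality
  turns this into a bound for \<open>W\<^sub>k/k\<^sup>2\<close> uniform in \<open>k \<ge> m\<close>, and with \<open>m \<approx> K \<surd>n\<close> the drift exceeds the
  noise with probability \<open>1 - O(K\<^sup>-\<^sup>2)\<close>.
\<close>

section \<open>Linear growth of the distribution function of a difference\<close>

text \<open>Steinhaus' argument: enclose a compact \<open>K\<close> inside \<open>E\<close> in an
  open \<open>U\<close> that exceeds it by less than half its measure. Small translates of
  \<open>K\<close> stay in \<open>U\<close>, so at most half of such a translate can miss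
  \<open>K\<close>, and the overlap is bounded below uniformly in the shift.\<close>

lemma overlap_of_small_translates:
  fixes E :: "real set"
  assumes E: "E \<in> sets borel" "bounded E" "emeasure lborel E > 0"
  obtains K \<eta> \<delta> where "compact K" "K \<subseteq> E" "\<eta> > 0" "\<delta> > 0"
    and "\<And>s. \<bar>s\<bar> \<le> \<eta> \<Longrightarrow> ennreal \<delta> \<le> emeasure lborel (K \<inter> {x. x + s \<in> K})"
proof -
  have bfin: "emeasure lborel B < \<infinity>" if "bounded B" for B :: "real set"
    using emeasure_bounded_finite[OF that] .
  define e where "e = measure lborel E"
  have emE: "emeasure lborel E = ennreal e"
    unfolding e_def using bfin[OF E(2)] by (simp add: emeasure_eq_ennreal_measure less_top)
  have e0: "e > 0" using E(3) emE by (simp add: ennreal_less_zero_iff)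
  \<comment> \<open>Inner approximation of \<open>E\<close> by outer approximation of its
    complement; an excess below \<open>e/2\<close> leaves \<open>K\<close> with positive
    measure.\<close>
  obtain V where V: "open V" "- E \<subseteq> V" "emeasure lebesgue (V - (- E)) < ennreal (e/2)"
    using sets_lebesgue_outer_open[of "-E" "e/2"] E(1) e0
    by (metis (no_types, lifting) borel_comp half_gt_zero sets_completionI_sets sets_lborel)
  define K where "K = - V"
  have K: "closed K" "K \<subseteq> E" using V by (auto simp: K_def)
  then have cK: "compact K" using E(2) bounded_subset compact_eq_bounded_closed by blast
  have Kb[measurable]: "K \<in> sets borel" using K by simp
  define k where "k = measure lborel K"
  have emK: "emeasure lborel K = ennreal k"
    unfolding k_def using bfin[OF compact_imp_bounded[OF cK]]
    by (simp add: emeasure_eq_ennreal_measure less_top)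
  have k0: "k \<ge> 0" by (simp add: k_def)
  have "emeasure lborel E = emeasure lborel K + emeasure lborel (E - K)"
    using plus_emeasure[of K lborel "E - K"] K(2) E(1) Kb by (simp add: Un_absorb1)
  moreover have "E - K = V - (- E)" using V by (auto simp: K_def)
  then have "emeasure lborel (E - K) < ennreal (e/2)"
    using V(1,3) E(1) by simp
  ultimately have "ennreal e < ennreal k + ennreal (e/2)"
    using emE emK by (simp add: ennreal_add_left_cancel_less)
  then have "e < k + e/2" using k0 e0 by (simp add: ennreal_less_iff flip: ennreal_plus)
  then have kpos: "k > 0" using e0 by simp
  obtain U where U: "open U" "K \<subseteq> U" "emeasure lebesgue (U - K) < ennreal (k/2)"
    using sets_lebesgue_outer_open[of K "k/2"] Kb kpos
    by (metis half_gt_zero sets_completionI_sets sets_lborel)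
  have Ub[measurable]: "U \<in> sets borel" using U by simp
  obtain r where r: "r > 0" "(\<Union>x\<in>K. ball x r) \<subseteq> U"
    using compact_subset_open_imp_ball_epsilon_subset[OF cK U(1,2)] by metis
  have main: "ennreal (k/2) \<le> emeasure lborel (K \<inter> {x. x + s \<in> K})" if s: "\<bar>s\<bar> \<le> r/2" for s
  proof -
    \<comment> \<open>The translate of \<open>K\<close> by \<open>-s\<close>. Halving the radius
      keeps the closed range of shifts inside the open balls of radius \<open>r\<close>.\<close>
    let ?T = "{x. x + s \<in> K}"
    have T[measurable]: "?T \<in> sets borel" by measurable
    have TU: "?T \<subseteq> U"
    proof
      fix x assume "x \<in> ?T"
      then have "x + s \<in> K" by simp
      moreover have "x \<in> ball (x+s) r" using s r(1) by (auto simp: dist_real_def)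
      ultimately show "x \<in> U" using r(2) by blast
    qed
    have "emeasure lborel ?T = emeasure (distr lborel borel ((+) s)) K"
      by (subst emeasure_distr) (auto simp: vimage_def add.commute)
    then have emT: "emeasure lborel ?T = ennreal k"
      using emK by (simp add: lborel_distr_plus)
    have "emeasure lborel (?T - K) \<le> emeasure lborel (U - K)"
      using TU by (intro emeasure_mono) auto
    also have "\<dots> \<le> ennreal (k/2)"
      using U(3) by simp
    finally have le: "emeasure lborel (?T - K) \<le> ennreal (k/2)" .
    have "ennreal (k/2) + ennreal (k/2) = emeasure lborel ?T"
      using kpos emT by (simp flip: ennreal_plus)
    also have "\<dots> = emeasure lborel (K \<inter> ?T) + emeasure lborel (?T - K)"
    proof -
      have "(K \<inter> ?T) \<inter> (?T - K) = {}" "K \<inter> ?T \<union> (?T - K) = ?T" by auto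
      then show ?thesis using plus_emeasure[of "K \<inter> ?T" lborel "?T - K"] by simp
    qed
    also have "\<dots> \<le> emeasure lborel (K \<inter> ?T) + ennreal (k/2)"
      by (intro add_left_mono le)
    finally show ?thesis
      by (simp add: ennreal_add_left_cancel_le add.commute)
  qed
  show ?thesis
    by (rule that[of K "r/2" "k/2"]) (use cK K r kpos main in auto)
qed

text \<open>The superlevel sets at \<open>1/(m+1)\<close>, cut to \<open>[-m, m]\<close>, exhaust
  the set where \<phi> is positive; if all were null, the total mass would be 0 instead of
  1.\<close>

lemma density_exceeds_on_bounded_set:
  fixes \<phi> :: "real \<Rightarrow> real"
  assumes \<phi>[measurable]: "\<phi> \<in> borel_measurable borel"
    and P: "prob_space (density lborel (\<lambda>z. ennreal (\<phi> z)))"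
  obtains a E where "a > 0" "E \<in> sets borel" "bounded E" "emeasure lborel E > 0" "\<And>z. z \<in> E \<Longrightarrow> \<phi> z \<ge> a"
proof -
  define E where "E m = {z. \<phi> z \<ge> 1 / real (Suc m)} \<inter> {-real m..real m}" for m
  have Eb[measurable]: "E m \<in> sets borel" for m
    unfolding E_def by measurable
  have "\<exists>m. emeasure lborel (E m) > 0"
  proof (rule ccontr)
    assume "\<nexists>m. emeasure lborel (E m) > 0"
    then have "E m \<in> null_sets lborel" for m
      using Eb by (auto simp: null_sets_def)
    then have null: "(\<Union>m. E m) \<in> null_sets lborel" by blast
    have "{z. \<phi> z > 0} \<subseteq> (\<Union>m. E m)"
    proof
      fix z assume "z \<in> {z. \<phi> z > 0}"
      then obtain m1 where m1: "1 / real (Suc m1) < \<phi> z"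
        using nat_approx_posE by blast
      obtain m2 :: nat where m2: "\<bar>z\<bar> \<le> real m2" using real_arch_simple by blast
      have "1 / real (Suc (max m1 m2)) \<le> 1 / real (Suc m1)"
        by (intro divide_left_mono) auto
      then have "z \<in> E (max m1 m2)" using m1 m2 by (auto simp: E_def)
      then show "z \<in> (\<Union>m. E m)" by blast
    qed
    then have "{z. \<phi> z > 0} \<in> null_sets lborel"
      by (intro null_sets_subset[OF null]) auto
    then have "AE z in lborel. \<phi> z \<le> 0"
      by (subst AE_iff_null) (auto simp: not_le)
    then have "(\<integral>\<^sup>+ z. ennreal (\<phi> z) \<partial>lborel) = 0"
      by (subst nn_integral_0_iff_AE) (auto simp: ennreal_eq_0_iff)
    moreover have "emeasure (density lborel (\<lambda>z. ennreal (\<phi> z))) UNIV = 1"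
      using prob_space.emeasure_space_1[OF P] by simp
    then have "(\<integral>\<^sup>+ z. ennreal (\<phi> z) \<partial>lborel) = 1"
      by (subst (asm) emeasure_density) auto
    ultimately show False by simp
  qed
  then obtain m where "emeasure lborel (E m) > 0" by blast
  moreover have "bounded (E m)" unfolding E_def by (intro bounded_Int) auto
  ultimately show ?thesis
    by (intro that[of "1 / real (Suc m)" "E m"]) (auto simp: E_def)
qed

text \<open>The difference of two independent variables with density \<phi> has density
  \<open>\<integral> \<phi>(x) \<phi>(x + s) dx\<close> at \<open>s\<close>. Since \<phi> is at
  least \<open>a\<close> on \<open>K\<close>, this is at least \<open>a^2\<close> times the overlap
  of \<open>K\<close> with its translate, hence at least \<open>a^2 * \<delta>\<close> for small
  \<open>s\<close>; the bound is then integrated over \<open>s\<close> in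
  \<open>(v, u]\<close>.\<close>

lemma difference_mass_near_zero:
  fixes \<phi> :: "real \<Rightarrow> real"
  defines "N \<equiv> density lborel (\<lambda>z. ennreal (\<phi> z))"
  assumes \<phi>[measurable]: "\<phi> \<in> borel_measurable borel" and P: "prob_space N"
  obtains c \<eta> where "c > 0" "\<eta> > 0"
    and "\<And>u v. -\<eta> \<le> v \<Longrightarrow> v \<le> u \<Longrightarrow> u \<le> \<eta> \<Longrightarrow>
      c * (u - v) \<le> measure (N \<Otimes>\<^sub>M N) {p. v < snd p - fst p \<and> snd p - fst p \<le> u}"
proof -
  obtain a E where E: "a > 0" "E \<in> sets borel" "bounded E" "emeasure lborel E > 0"
      "\<And>z. z \<in> E \<Longrightarrow> \<phi> z \<ge> a"
    using density_exceeds_on_bounded_set[OF \<phi>] P unfolding N_def by metis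
  obtain K \<eta> \<delta> where K: "compact K" "K \<subseteq> E" "\<eta> > 0" "\<delta> > 0"
    "\<And>s. \<bar>s\<bar> \<le> \<eta> \<Longrightarrow> ennreal \<delta> \<le> emeasure lborel (K \<inter> {x. x + s \<in> K})"
    using overlap_of_small_translates[OF E(2-4)] by metis
  have Kb[measurable]: "K \<in> sets borel" using K(1) by (simp add: borel_compact)
  interpret N: prob_space N by fact
  interpret NN: pair_prob_space N N ..
  have sN[measurable_cong]: "sets N = sets borel" by (simp add: N_def)
  have ind: "ennreal a * indicator K z \<le> ennreal (\<phi> z)" for z
    using E(5)[of z] K(2) E(1) by (auto simp: indicator_def intro: ennreal_leI)
  have "a\<^sup>2 * \<delta> * (u - v) \<le> measure (N \<Otimes>\<^sub>M N) {p. v < snd p - fst p \<and> snd p - fst p \<le> u}"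
    if uv: "-\<eta> \<le> v" "v \<le> u" "u \<le> \<eta>" for u v
  proof -
    let ?A = "{p :: real \<times> real. v < snd p - fst p \<and> snd p - fst p \<le> u}"
    have "{p \<in> space (borel \<Otimes>\<^sub>M borel). v < snd p - fst p \<and> snd p - fst p \<le> u} \<in> sets (borel \<Otimes>\<^sub>M (borel :: real measure))"
      by measurable
    then have A: "?A \<in> sets (N \<Otimes>\<^sub>M N)"
      by (simp add: space_pair_measure cong: sets_pair_measure_cong[OF sN sN])
    have "ennreal (a\<^sup>2 * \<delta> * (u - v)) = (\<integral>\<^sup>+s. ennreal (a\<^sup>2) * ennreal \<delta> * indicator {v<..u} s \<partial>lborel)"
      using uv K(4) by (subst nn_integral_cmult_indicator) (auto simp: ennreal_mult)
    also have "\<dots> \<le> (\<integral>\<^sup>+s. ennreal (a\<^sup>2) * emeasure lborel (K \<inter> {x. x + s \<in> K}) * indicator {v<..u} s \<partial>lborel)"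
    proof (intro nn_integral_mono)
      fix s
      show "ennreal (a\<^sup>2) * ennreal \<delta> * indicator {v<..u} s
        \<le> ennreal (a\<^sup>2) * emeasure lborel (K \<inter> {x. x + s \<in> K}) * indicator {v<..u} s"
        using K(5)[of s] uv by (auto simp: indicator_def intro!: mult_left_mono)
    qed
    \<comment> \<open>The overlap is written as an integral of a product, so that after the exchange
      of integrals each factor can be replaced by \<phi> through \<open>ind\<close>.\<close>
    also have "\<dots> = (\<integral>\<^sup>+s. (\<integral>\<^sup>+x. (ennreal a * indicator K x) * (ennreal a * indicator K (x + s) * indicator {v<..u} s) \<partial>lborel) \<partial>lborel)"
    proof (intro nn_integral_cong)
      fix s
      have "ennreal (a\<^sup>2) * emeasure lborel (K \<inter> {x. x + s \<in> K}) * indicator {v<..u} s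
        = (\<integral>\<^sup>+x. (ennreal (a\<^sup>2) * indicator {v<..u} s) * indicator (K \<inter> {x. x + s \<in> K}) x \<partial>lborel)"
        by (subst nn_integral_cmult_indicator) (auto simp: mult_ac)
      also have "\<dots> = (\<integral>\<^sup>+x. (ennreal a * indicator K x) * (ennreal a * indicator K (x + s) * indicator {v<..u} s) \<partial>lborel)"
        using E(1) by (intro nn_integral_cong)
          (auto simp: indicator_def power2_eq_square ennreal_mult)
      finally show "ennreal (a\<^sup>2) * emeasure lborel (K \<inter> {x. x + s \<in> K}) * indicator {v<..u} s = \<dots>" .
    qed
    also have "\<dots> = (\<integral>\<^sup>+x. (\<integral>\<^sup>+s. (ennreal a * indicator K x) * (ennreal a * indicator K (x + s) * indicator {v<..u} s) \<partial>lborel) \<partial>lborel)"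
      by (rule lborel_pair.Fubini') measurable
    also have "\<dots> \<le> (\<integral>\<^sup>+x. (\<integral>\<^sup>+s. ennreal (\<phi> x) * (ennreal (\<phi> (x + s)) * indicator {v<..u} s) \<partial>lborel) \<partial>lborel)"
      by (intro nn_integral_mono mult_mono ind) auto
    also have "\<dots> = (\<integral>\<^sup>+x. ennreal (\<phi> x) * (\<integral>\<^sup>+s. ennreal (\<phi> (x + s)) * indicator {v<..u} s \<partial>lborel) \<partial>lborel)"
      by (intro nn_integral_cong nn_integral_cmult) measurable
    \<comment> \<open>Substituting \<open>y = x + s\<close> turns the inner integral into the mass
      of the section of \<open>?A\<close> at \<open>x\<close>.\<close>
    also have "\<dots> = (\<integral>\<^sup>+x. ennreal (\<phi> x) * emeasure N (Pair x -` ?A) \<partial>lborel)"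
    proof (intro nn_integral_cong arg_cong2[where f="(*)"] refl)
      fix x
      have "emeasure N (Pair x -` ?A) = (\<integral>\<^sup>+y. ennreal (\<phi> y) * indicator {v<..u} (y - x) \<partial>lborel)"
        unfolding N_def by (subst emeasure_density) (auto intro!: nn_integral_cong simp: indicator_def)
      also have "\<dots> = (\<integral>\<^sup>+s. ennreal (\<phi> (x + s)) * indicator {v<..u} s \<partial>lborel)"
        by (subst nn_integral_real_affine[where c=1 and t=x]) auto
      finally show "(\<integral>\<^sup>+s. ennreal (\<phi> (x + s)) * indicator {v<..u} s \<partial>lborel) = emeasure N (Pair x -` ?A)" by simp
    qed
    also have "\<dots> = (\<integral>\<^sup>+x. emeasure N (Pair x -` ?A) \<partial>N)"
      using N.measurable_emeasure_Pair[OF A] by (subst (2) N_def, subst nn_integral_density) (auto simp: N_def)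
    also have "\<dots> = emeasure (N \<Otimes>\<^sub>M N) ?A"
      by (rule N.emeasure_pair_measure_alt[symmetric, OF A])
    finally show ?thesis
      using K(4) by (simp add: NN.emeasure_eq_measure)
  qed
  then show ?thesis
    using E(1) K(3,4) by (intro that[of "a\<^sup>2 * \<delta>" \<eta>]) auto
qed

section \<open>Cyclic shifts of periodic functions\<close>

text \<open>One grid step drops the first term and adds the term one full period later, which has
  the same value. Two-sided induction extends this to integer shifts.\<close>

lemma sum_periodic_shift:
  fixes u :: "real \<Rightarrow> real" and k :: int
  assumes per: "\<And>x. u (x + 1) = u x"
  shows "(\<Sum>i = 1..n. u (real i / real n + of_int k / real n)) = (\<Sum>i = 1..n. u (real i / real n))"
proof (cases "n = 0")
  case False
  define S where "S y = (\<Sum>i = 1..n. u ((real i + y) / real n))" for y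
  have step: "S (y + 1) = S y" for y
  proof -
    let ?g = "\<lambda>i. u ((real i + y) / real n)"
    have "S (y + 1) = (\<Sum>i = 1..n. ?g (Suc i))"
      by (simp add: S_def add_ac)
    also have "\<dots> = (\<Sum>i = Suc 1..Suc n. ?g i)"
      by (rule sum.shift_bounds_cl_Suc_ivl[symmetric])
    also have "\<dots> = (\<Sum>i = 1..Suc n. ?g i) - ?g 1"
      by (subst (2) sum.atLeast_Suc_atMost) auto
    also have "\<dots> = S y + ?g (Suc n) - ?g 1"
      by (simp add: S_def)
    also have "?g (Suc n) = u ((1 + y) / real n + 1)"
      using False by (intro arg_cong[of _ _ u]) (simp add: field_simps)
    finally show ?thesis using per by simp
  qed
  have "S (of_int k) = S 0"
  proof (induction k rule: int_induct[where k=0])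
    case (step1 i) then show ?case using step[of "of_int i"] by simp
  next
    case (step2 i) then show ?case using step[of "of_int i - 1"] by simp
  qed simp
  then show ?thesis by (simp add: S_def add_divide_distrib)
qed simp

lemma periodic_of_int:
  fixes u :: "real \<Rightarrow> 'b"
  assumes per: "\<And>x. u (x + 1) = u x"
  shows "u (x + of_int k) = u x"
proof (induction k rule: int_induct[where k=0])
  case (step1 i) then show ?case using per[of "x + of_int i"] by (simp add: add_ac)
next
  case (step2 i) then show ?case using per[of "x + of_int i - 1"] by (simp add: algebra_simps)
qed simp

text \<open>Moving \<open>y\<close> by an integer brings it within distance 1 of \<open>x\<close>
  without changing \<open>g y\<close>.\<close>

lemma periodic_lipschitz_oscillation:
  fixes g :: "real \<Rightarrow> real"
  assumes lip: "\<And>x y. \<bar>g x - g y\<bar> \<le> L * \<bar>x - y\<bar>" and L: "L \<ge> 0"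
    and per: "\<And>x. g (x + 1) = g x"
  shows "\<bar>g x - g y\<bar> \<le> L"
proof -
  have "\<bar>x - (y + of_int \<lfloor>x - y\<rfloor>)\<bar> \<le> 1" by linarith
  then have "L * \<bar>x - (y + of_int \<lfloor>x - y\<rfloor>)\<bar> \<le> L" using L by (simp add: mult_left_le)
  then show ?thesis
    using lip[of x "y + of_int \<lfloor>x - y\<rfloor>"] periodic_of_int[of g, OF per] by (metis order_trans)
qed

section \<open>Convexity and the rearrangement inequality\<close>

lemma mono_integral_bounds:
  fixes F :: "real \<Rightarrow> real"
  assumes F: "mono F" and xy: "x \<le> y"
  shows "F x * (y - x) \<le> integral {x..y} F" "integral {x..y} F \<le> F y * (y - x)"
proof -
  have int: "F integrable_on {x..y}"
    by (rule integrable_on_mono_on) (use F in \<open>auto simp: mono_on_def mono_def\<close>)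
  have "integral {x..y} (\<lambda>_. F x) \<le> integral {x..y} F"
    by (rule integral_le[OF _ int]) (use F in \<open>auto simp: mono_def\<close>)
  then show "F x * (y - x) \<le> integral {x..y} F" using xy by (simp add: mult.commute)
  have "integral {x..y} F \<le> integral {x..y} (\<lambda>_. F y)"
    by (rule integral_le[OF int]) (use F in \<open>auto simp: mono_def\<close>)
  then show "integral {x..y} F \<le> F y * (y - x)" using xy by (simp add: mult.commute)
qed

text \<open>The primitive of \<open>F\<close> is convex, and its sums over \<open>a\<close> and \<open>b\<close> cancel.\<close>
lemma rearrangement_gap:
  fixes F :: "real \<Rightarrow> real" and a b :: "'i \<Rightarrow> real"
  assumes F: "mono F" and I: "finite I"
    and perm: "\<And>G :: real \<Rightarrow> real. (\<Sum>i\<in>I. G (a i)) = (\<Sum>i\<in>I. G (b i))"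
  shows "(\<Sum>i\<in>I. (a i - b i) / 2 * (F (a i) - F ((a i + b i) / 2))) \<le> (\<Sum>i\<in>I. F (a i) * (a i - b i))"
proof -
  have "bdd_below (a ` I \<union> b ` I)" using I by (intro bdd_below_finite) auto
  \<comment> \<open>A common left endpoint gives a single primitive \<open>G\<close> for all the
    values, to which \<open>perm\<close> can be applied.\<close>
  then obtain A where A: "\<And>i. i \<in> I \<Longrightarrow> A \<le> a i" "\<And>i. i \<in> I \<Longrightarrow> A \<le> b i"
    unfolding bdd_below_def by blast
  define G where "G y = integral {A..y} F" for y
  have int: "F integrable_on {x..y}" for x y
    by (rule integrable_on_mono_on) (use F in \<open>auto simp: mono_on_def mono_def\<close>)
  have G: "G y = G x + integral {x..z} F + integral {z..y} F" if "A \<le> x" "x \<le> z" "z \<le> y" for x y z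
    unfolding G_def using that
      Henstock_Kurzweil_Integration.integral_combine[of A x y F]
      Henstock_Kurzweil_Integration.integral_combine[of x z y F] int by fastforce
  \<comment> \<open>The integral of \<open>F\<close> between \<open>b i\<close> and
    \<open>a i\<close> is split at the midpoint. Bounding \<open>F\<close> by its value at the
    midpoint on the half next to \<open>b i\<close>, and by \<open>F (a i)\<close> on the other
    half, leaves exactly the claimed gap.\<close>
  have "(a i - b i) / 2 * (F (a i) - F ((a i + b i) / 2)) \<le> F (a i) * (a i - b i) - (G (a i) - G (b i))"
    if i: "i \<in> I" for i
  proof -
    define m where "m = (a i + b i) / 2"
    show ?thesis
    proof (cases "b i \<le> a i")
      case True
      then have m: "b i \<le> m" "m \<le> a i" by (auto simp: m_def)
      have "G (a i) - G (b i) \<le> F m * (m - b i) + F (a i) * (a i - m)"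
        using G[OF A(2)[OF i] m] mono_integral_bounds(2)[OF F m(1)] mono_integral_bounds(2)[OF F m(2)] by linarith
      then show ?thesis unfolding m_def by (simp add: field_simps)
    next
      case False
      then have m: "a i \<le> m" "m \<le> b i" by (auto simp: m_def)
      have "G (b i) - G (a i) \<ge> F (a i) * (m - a i) + F m * (b i - m)"
        using G[OF A(1)[OF i] m] mono_integral_bounds(1)[OF F m(1)] mono_integral_bounds(1)[OF F m(2)] by linarith
      then show ?thesis unfolding m_def by (simp add: field_simps)
    qed
  qed
  then have "(\<Sum>i\<in>I. (a i - b i) / 2 * (F (a i) - F ((a i + b i) / 2)))
      \<le> (\<Sum>i\<in>I. F (a i) * (a i - b i) - (G (a i) - G (b i)))"
    by (rule sum_mono)
  also have "\<dots> = (\<Sum>i\<in>I. F (a i) * (a i - b i))"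
    by (simp add: sum_subtractf perm[of G])
  finally show ?thesis .
qed

section \<open>Quadratic lower bound for the energy of a grid shift\<close>

text \<open>A one-sided window of \<open>q + 1\<close> points suffices: as
  \<open>2 * q \<le> n\<close>, it fits to the right or to the left of \<open>i\<close>. This avoids
  wrapping around the circle.\<close>

lemma card_grid_window:
  fixes r :: real
  assumes i: "1 \<le> i" "i \<le> n" and r: "0 \<le> r" "r \<le> 1/2"
  shows "r * real n \<le> real (card {j \<in> {1..n}. \<bar>real j / real n - real i / real n\<bar> \<le> r})"
proof -
  define q where "q = nat \<lfloor>r * real n\<rfloor>"
  have q: "real q \<le> r * real n" "r * real n < real q + 1"
    unfolding q_def using r by auto
  have "r * real n \<le> real n / 2" using mult_right_mono[OF r(2), of "real n"] by simp
  then have qn: "2 * q \<le> n" using q(1) by linarith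
  define J where "J = (if i + q \<le> n then {i..i+q} else {i-q..i})"
  have iq: "q < i" if "\<not> i + q \<le> n" using that qn by linarith
  have cJ: "card J = q + 1" unfolding J_def using iq by auto
  have "J \<subseteq> {j \<in> {1..n}. \<bar>real j / real n - real i / real n\<bar> \<le> r}"
  proof
    fix j assume j: "j \<in> J"
    then have "\<bar>real j - real i\<bar> \<le> real q" "j \<in> {1..n}"
      using iq i by (auto simp: J_def split: if_splits)
    then have "\<bar>real j - real i\<bar> \<le> r * real n" "n > 0" "j \<in> {1..n}" using q(1) i by auto
    then show "j \<in> {j \<in> {1..n}. \<bar>real j / real n - real i / real n\<bar> \<le> r}"
      by (simp add: diff_divide_distrib[symmetric] abs_divide divide_le_eq)
  qed
  then have "card J \<le> card {j \<in> {1..n}. \<bar>real j / real n - real i / real n\<bar> \<le> r}"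
    by (intro card_mono) auto
  then show ?thesis using cJ q(2) by linarith
qed

text \<open>Compactness: shifts in \<open>S\<close> that move \<open>g\<close> by less and less in
  the supremum would accumulate at a shift in \<open>S\<close> that leaves \<open>g\<close>
  unchanged.\<close>

lemma uniform_shift_separation:
  fixes g :: "real \<Rightarrow> real"
  assumes cont: "continuous_on UNIV g" and S: "compact S"
    and sep: "\<And>t. t \<in> S \<Longrightarrow> \<exists>x. g x \<noteq> g (x - t)"
  obtains \<epsilon> where "\<epsilon> > 0" "\<And>t. t \<in> S \<Longrightarrow> \<exists>x. \<bar>g x - g (x - t)\<bar> \<ge> \<epsilon>"
proof -
  have "\<exists>\<epsilon>>0. \<forall>t\<in>S. \<exists>x. \<bar>g x - g (x - t)\<bar> \<ge> \<epsilon>"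
  proof (rule ccontr)
    assume neg: "\<not> ?thesis"
    have "\<exists>t\<in>S. \<forall>x. \<bar>g x - g (x - t)\<bar> < 1 / real (Suc m)" for m
    proof -
      have "1 / real (Suc m) > 0" by simp
      then have "\<not> (\<forall>t\<in>S. \<exists>x. 1 / real (Suc m) \<le> \<bar>g x - g (x - t)\<bar>)" using neg by blast
      then show ?thesis by (auto simp: not_le)
    qed
    then obtain t where t: "\<And>m. t m \<in> S" "\<And>m x. \<bar>g x - g (x - t m)\<bar> < 1 / real (Suc m)"
      by metis
    obtain l q where l: "l \<in> S" "strict_mono q" "(t \<circ> q) \<longlonglongrightarrow> l"
      using S t(1) unfolding compact_def by metis
    obtain x where x: "g x \<noteq> g (x - l)" using sep[OF l(1)] by blast
    have tq: "(\<lambda>m. t (q m)) \<longlonglongrightarrow> l" using l(3) by (simp add: o_def)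
    have "(\<lambda>m. x - t (q m)) \<longlonglongrightarrow> x - l" by (intro tendsto_intros tq)
    then have "(\<lambda>m. g (x - t (q m))) \<longlonglongrightarrow> g (x - l)"
      by (rule continuous_on_tendsto_compose[OF cont]) auto
    then have lim: "(\<lambda>m. \<bar>g x - g (x - t (q m))\<bar>) \<longlonglongrightarrow> \<bar>g x - g (x - l)\<bar>"
      by (intro tendsto_intros)
    have "(\<lambda>m. 1 / real (Suc (q m))) \<longlonglongrightarrow> 0"
      using LIMSEQ_subseq_LIMSEQ[OF LIMSEQ_Suc[OF lim_1_over_n] l(2)] by (simp add: o_def)
    then have "\<bar>g x - g (x - l)\<bar> \<le> 0"
      by (rule LIMSEQ_le[OF lim]) (use t(2) less_imp_le in blast)
    then show False using x by simp
  qed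
  then show ?thesis using that by blast
qed

text \<open>A shift by \<open>N * k\<close> is made of \<open>N\<close> shifts by \<open>k\<close>,
  all of equal energy by periodicity; Cauchy-Schwarz over the \<open>N\<close> pieces gives the
  factor \<open>N^2\<close>. It serves to bound the energy of a small shift from below by that of a
  large one.\<close>

lemma shift_energy_multiple:
  fixes g :: "real \<Rightarrow> real" and k :: int
  assumes per: "\<And>x. g (x + 1) = g x"
  shows "(\<Sum>i = 1..n. (g (real i / real n) - g (real i / real n - real N * of_int k / real n))\<^sup>2)
    \<le> (real N)\<^sup>2 * (\<Sum>i = 1..n. (g (real i / real n) - g (real i / real n - of_int k / real n))\<^sup>2)"
proof -
  define u where "u x = (g x - g (x - of_int k / real n))\<^sup>2" for x
  have uper: "u (x + 1) = u x" for x
    using per[of x] per[of "x - of_int k / real n"] by (simp add: u_def algebra_simps)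
  have *: "(g x - g (x - real N * of_int k / real n))\<^sup>2
      \<le> real N * (\<Sum>p<N. u (x - real p * of_int k / real n))" for x
  proof -
    define d where "d p = g (x - real p * of_int k / real n) - g (x - real (Suc p) * of_int k / real n)" for p
    have "(\<Sum>p<N. d p) = g x - g (x - real N * of_int k / real n)"
      unfolding d_def by (subst sum_lessThan_telescope') simp
    moreover have "(\<Sum>p<N. d p)\<^sup>2 \<le> (\<Sum>p<N. (d p)\<^sup>2) * real (card {..<N})"
      by (rule sum_squared_le_sum_of_squares)
    moreover have "(d p)\<^sup>2 = u (x - real p * of_int k / real n)" for p
      unfolding d_def u_def by (simp add: algebra_simps add_divide_distrib)
    ultimately show ?thesis by (simp add: mult.commute)
  qed
  have "(\<Sum>i = 1..n. (g (real i / real n) - g (real i / real n - real N * of_int k / real n))\<^sup>2)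
      \<le> (\<Sum>i = 1..n. real N * (\<Sum>p<N. u (real i / real n - real p * of_int k / real n)))"
    by (intro sum_mono *)
  also have "\<dots> = real N * (\<Sum>p<N. \<Sum>i = 1..n. u (real i / real n + of_int (- int p * k) / real n))"
    by (subst sum.swap) (simp add: sum_distrib_left)
  also have "\<dots> = real N * (\<Sum>p<N. \<Sum>i = 1..n. u (real i / real n))"
    by (simp only: sum_periodic_shift[of u, OF uper])
  finally show ?thesis by (simp add: u_def power2_eq_square mult_ac)
qed

text \<open>A small shift is repeated until it lies between 1/4 and 1/2, where \<open>g\<close> is
  moved by at least \<epsilon> somewhere and, by the Lipschitz bound, by a fixed amount on a fixed
  fraction of the grid. Dividing by the square of the number of repetitions, about
  \<open>n / (2 * k)\<close>, leaves the factor \<open>(k/n)^2\<close>.\<close>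

lemma shift_energy_quadratic_growth:
  fixes g :: "real \<Rightarrow> real"
  assumes lip: "\<And>x y. \<bar>g x - g y\<bar> \<le> L * \<bar>x - y\<bar>" and L: "L > 0"
    and per: "\<And>x. g (x + 1) = g x"
    and \<epsilon>: "\<epsilon> > 0" "\<And>t. 1/4 \<le> t \<Longrightarrow> t \<le> 1/2 \<Longrightarrow> \<exists>x. \<bar>g x - g (x - t)\<bar> \<ge> \<epsilon>"
  obtains c where "c > 0"
    and "\<And>n k. real n \<ge> 4 * L / \<epsilon> \<Longrightarrow> 1 \<le> k \<Longrightarrow> 2 * k \<le> n \<Longrightarrow>
      c * (real k / real n)\<^sup>2 \<le> (\<Sum>i = 1..n. (g (real i / real n) - g (real i / real n - real k / real n))\<^sup>2) / real n"
proof -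
  define r where "r = min (1/2) (\<epsilon> / (8 * L))"
  have r: "0 < r" "r \<le> 1/2" "2 * L * r \<le> \<epsilon> / 4"
    using L \<epsilon>(1) by (auto simp: r_def min_def field_simps)
  \<comment> \<open>The factor 4 reflects \<open>2 * N * k \<le> n\<close> for the number
    \<open>N\<close> of repetitions.\<close>
  define c where "c = 4 * (r * (\<epsilon> / 4)\<^sup>2)"
  have "c * (real k / real n)\<^sup>2 \<le> (\<Sum>i = 1..n. (g (real i / real n) - g (real i / real n - real k / real n))\<^sup>2) / real n"
    if n: "real n \<ge> 4 * L / \<epsilon>" and k: "1 \<le> k" "2 * k \<le> n" for n k
  proof -
    define N where "N = n div (2 * k)"
    have "n = 2 * (N * k) + n mod (2 * k)"
      unfolding N_def using div_mult_mod_eq[of n "2 * k"] by (simp only: mult.left_commute mult.assoc)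
    moreover have "n mod (2 * k) < 2 * k" using k by simp
    ultimately have N: "2 * (N * k) \<le> n" "n < 2 * (N * k) + 2 * k" by linarith+
    have "1 \<le> N" unfolding N_def using k by (simp add: div_greater_zero_iff Suc_le_eq)
    then have "k \<le> N * k" by simp
    then have "n \<le> 4 * (N * k)" using N(2) by linarith
    then have "real n \<le> real (4 * (N * k))" "real (2 * (N * k)) \<le> real n"
      using N(1) by (simp_all only: of_nat_le_iff)
    then have Nk4: "real n \<le> 4 * (real N * real k)" and Nk: "2 * (real N * real k) \<le> real n"
      by simp_all
    have n0: "real n > 0" using k by simp
    define t where "t = real N * real k / real n"
    have "1/4 \<le> t" "t \<le> 1/2" using n0 Nk Nk4 by (auto simp: t_def field_simps)
    then obtain x0 where x0: "\<bar>g x0 - g (x0 - t)\<bar> \<ge> \<epsilon>" using \<epsilon>(2) by blast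
    define D where "D x = g x - g (x - t)" for x
    have Dper: "D (x + 1) = D x" for x using per[of x] per[of "x - t"] by (simp add: D_def algebra_simps)
    have Dlip: "\<bar>D x\<bar> \<ge> \<bar>D y\<bar> - 2 * L * \<bar>x - y\<bar>" for x y
      using lip[of x y] lip[of "x - t" "y - t"] unfolding D_def by simp
    \<comment> \<open>The half-open interval \<open>(0, 1]\<close> is chosen so that the ceiling of
      \<open>n * x\<close> is an index in \<open>{1..n}\<close>.\<close>
    define x where "x = x0 + of_int (1 - \<lceil>x0\<rceil>)"
    have x: "0 < x" "x \<le> 1" unfolding x_def by (simp_all, linarith+)
    have Dx: "\<bar>D x\<bar> \<ge> \<epsilon>"
      unfolding x_def periodic_of_int[of D, OF Dper] using x0 by (simp add: D_def)
    define i where "i = nat \<lceil>real n * x\<rceil>"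
    have nx: "0 < real n * x" "real n * x \<le> real n" using x n0 by (auto simp: mult_left_le)
    then have "int i = \<lceil>real n * x\<rceil>" by (simp add: i_def)
    then have i: "1 \<le> i" "i \<le> n" "real n * x \<le> real i" "real i \<le> real n * x + 1"
      using nx by linarith+
    have "\<bar>real i / real n - x\<bar> \<le> 1 / real n"
    proof -
      have "real i / real n - x = (real i - real n * x) / real n" using n0 by (simp add: diff_divide_distrib)
      moreover have "\<bar>real i - real n * x\<bar> \<le> 1" using i(3,4) by simp
      ultimately show ?thesis using n0 by (simp add: abs_divide divide_right_mono)
    qed
    then have "2 * L * \<bar>real i / real n - x\<bar> \<le> 2 * L * (1 / real n)"
      using L by (intro mult_left_mono) auto
    also have "\<dots> \<le> \<epsilon> / 2" using n n0 \<epsilon>(1) by (simp add: field_simps)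
    finally have Di: "\<bar>D (real i / real n)\<bar> \<ge> \<epsilon> / 2" using Dlip[of x "real i / real n"] Dlip[of "real i / real n" x] Dx
      by (simp add: abs_minus_commute)
    define J where "J = {j \<in> {1..n}. \<bar>real j / real n - real i / real n\<bar> \<le> r}"
    have cJ: "r * real n \<le> real (card J)"
      unfolding J_def using card_grid_window[OF i(1,2)] r by simp
    have DJ: "(\<epsilon> / 4)\<^sup>2 \<le> (D (real j / real n))\<^sup>2" if "j \<in> J" for j
    proof -
      have "2 * L * \<bar>real j / real n - real i / real n\<bar> \<le> 2 * L * r"
        using that L by (intro mult_left_mono) (auto simp: J_def)
      then have "\<epsilon> / 4 \<le> \<bar>D (real j / real n)\<bar>"
        using Dlip[of "real i / real n" "real j / real n"] Dlip[of "real j / real n" "real i / real n"] Di r(3) by linarith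
      then show ?thesis using \<epsilon>(1) by (metis abs_le_square_iff abs_of_nonneg divide_nonneg_pos less_imp_le zero_less_numeral)
    qed
    have "r * real n * (\<epsilon> / 4)\<^sup>2 \<le> real (card J) * (\<epsilon> / 4)\<^sup>2" using cJ by (intro mult_right_mono) auto
    also have "\<dots> = (\<Sum>j\<in>J. (\<epsilon> / 4)\<^sup>2)" by simp
    also have "\<dots> \<le> (\<Sum>j\<in>J. (D (real j / real n))\<^sup>2)" by (intro sum_mono DJ)
    also have "\<dots> \<le> (\<Sum>j = 1..n. (D (real j / real n))\<^sup>2)" by (intro sum_mono2) (auto simp: J_def)
    also have "\<dots> \<le> (real N)\<^sup>2 * (\<Sum>i = 1..n. (g (real i / real n) - g (real i / real n - real k / real n))\<^sup>2)"
      using shift_energy_multiple[of g n N "int k", OF per] by (simp add: D_def t_def)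
    finally have 1: "r * real n * (\<epsilon> / 4)\<^sup>2 \<le> (real N)\<^sup>2 * (\<Sum>i = 1..n. (g (real i / real n) - g (real i / real n - real k / real n))\<^sup>2)"
      (is "_ \<le> _ * ?E") .
    have E0: "?E \<ge> 0" by (intro sum_nonneg) auto
    have "(2 * real k)\<^sup>2 * (r * real n * (\<epsilon> / 4)\<^sup>2) \<le> (2 * real k)\<^sup>2 * ((real N)\<^sup>2 * ?E)"
      by (intro mult_left_mono 1) auto
    also have "\<dots> = (2 * (real N * real k))\<^sup>2 * ?E" by (simp add: power_mult_distrib)
    also have "\<dots> \<le> (real n)\<^sup>2 * ?E" using E0 Nk by (intro mult_right_mono power_mono) auto
    finally have "c * (real k)\<^sup>2 * real n \<le> (real n)\<^sup>2 * ?E" by (simp add: c_def power_mult_distrib mult_ac)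
    then show ?thesis using n0 by (simp add: power_divide field_simps power2_eq_square)
  qed
  moreover have "c > 0" using r \<epsilon>(1) by (simp add: c_def)
  ultimately show ?thesis using that by blast
qed

section \<open>Drift of the mean objective\<close>

text \<open>Growth of \<open>F\<close> is available only on \<open>[-\<eta>, \<eta>]\<close>. A step
  of size \<open>e\<close> stays there and monotonicity covers the rest of the way to
  \<open>u - d/2\<close>; as \<open>d\<close> is bounded by \<open>L\<close>, the truncated step is
  still proportional to \<open>d\<close>.\<close>

lemma monotone_pull:
  fixes F :: "real \<Rightarrow> real"
  assumes F: "mono F" and c: "c > 0" and \<eta>: "0 < \<eta>" "\<eta> \<le> L"
    and growth: "\<And>u v. -\<eta> \<le> v \<Longrightarrow> v \<le> u \<Longrightarrow> u \<le> \<eta> \<Longrightarrow> c * (u - v) \<le> F u - F v"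
    and u: "\<bar>u\<bar> \<le> \<eta> / 2" and d: "\<bar>d\<bar> \<le> L"
  shows "c * \<eta> / (4 * L) * d\<^sup>2 \<le> d / 2 * (F u - F (u - d / 2))"
proof -
  define e where "e = min (\<bar>d\<bar> / 2) (\<eta> / 2)"
  have L: "L > 0" using \<eta> by simp
  have "\<bar>d\<bar> * \<eta> \<le> \<bar>d\<bar> * L" "\<bar>d\<bar> * \<eta> \<le> L * \<eta>"
    using \<eta> d by (auto intro: mult_left_mono mult_right_mono)
  then have e: "\<bar>d\<bar> * \<eta> / (2 * L) \<le> e" "e \<le> \<bar>d\<bar> / 2" "e \<le> \<eta> / 2" "0 \<le> e"
    using L \<eta> by (auto simp: e_def field_simps)
  have "c * e \<le> \<bar>F u - F (u - d / 2)\<bar> \<and> 0 \<le> d * (F u - F (u - d / 2))"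
  proof (cases "d \<ge> 0")
    case True
    have "c * e \<le> F u - F (u - e)" using growth[of "u - e" u] e u by auto
    moreover have "F (u - d / 2) \<le> F (u - e)" using e True by (intro monoD[OF F]) auto
    moreover have "F (u - d / 2) \<le> F u" using True by (intro monoD[OF F]) auto
    ultimately show ?thesis using True by auto
  next
    case False
    have "c * e \<le> F (u + e) - F u" using growth[of u "u + e"] e u by auto
    moreover have "F (u + e) \<le> F (u - d / 2)" using e False by (intro monoD[OF F]) auto
    moreover have "F u \<le> F (u - d / 2)" using False by (intro monoD[OF F]) auto
    ultimately show ?thesis using False by (auto simp: mult_nonpos_nonpos)
  qed
  then have *: "c * e \<le> \<bar>F u - F (u - d / 2)\<bar>" "d * (F u - F (u - d / 2)) = \<bar>d\<bar> * \<bar>F u - F (u - d / 2)\<bar>"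
    by (auto simp: abs_mult[symmetric])
  have "c * \<eta> / (4 * L) * d\<^sup>2 = \<bar>d\<bar> / 2 * (c * (\<bar>d\<bar> * \<eta> / (2 * L)))"
    by (simp add: power2_eq_square field_simps abs_mult[symmetric])
  also have "\<dots> \<le> \<bar>d\<bar> / 2 * (c * e)" using e(1) c by (intro mult_left_mono) auto
  also have "\<dots> \<le> \<bar>d\<bar> / 2 * \<bar>F u - F (u - d / 2)\<bar>" using *(1) by (intro mult_left_mono) auto
  also have "\<dots> = d / 2 * (F u - F (u - d / 2))" using *(2) by simp
  finally show ?thesis .
qed

text \<open>For each fixed \<open>j\<close> the rearrangement gap applies to the values
  \<open>a i - a j\<close> and \<open>b i - a j\<close>. All gap terms are nonnegative, and those
  with \<open>j\<close> near \<open>i\<close> are of order \<open>(a i - b i)^2\<close> because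
  \<open>a i - a j\<close> then lies where \<open>F\<close> grows.\<close>

lemma population_drift:
  fixes F g :: "real \<Rightarrow> real" and k :: int
  assumes F: "mono F" and c: "c > 0" and \<eta>: "0 < \<eta>" "\<eta> \<le> L"
    and growth: "\<And>u v. -\<eta> \<le> v \<Longrightarrow> v \<le> u \<Longrightarrow> u \<le> \<eta> \<Longrightarrow> c * (u - v) \<le> F u - F v"
    and lip: "\<And>x y. \<bar>g x - g y\<bar> \<le> L * \<bar>x - y\<bar>" and per: "\<And>x. g (x + 1) = g x"
  shows "c * \<eta>\<^sup>2 / (8 * L\<^sup>2) * real n *
      (\<Sum>i = 1..n. (g (real i / real n) - g (real i / real n - of_int k / real n))\<^sup>2)
    \<le> (\<Sum>i = 1..n. \<Sum>j = 1..n. F (g (real i / real n) - g (real j / real n)) *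
      (g (real i / real n) - g (real i / real n - of_int k / real n)))"
proof -
  have L: "L > 0" using \<eta> by simp
  define a where "a i = g (real i / real n)" for i
  define b where "b i = g (real i / real n - of_int k / real n)" for i
  define T where "T i j = (a i - b i) / 2 * (F (a i - a j) - F ((a i + b i) / 2 - a j))" for i j
  have rearr: "(\<Sum>i = 1..n. T i j) \<le> (\<Sum>i = 1..n. F (a i - a j) * (a i - b i))" for j
  proof -
    define A where "A i = a i - a j" for i
    define B where "B i = b i - a j" for i
    have "(\<Sum>i = 1..n. G (A i)) = (\<Sum>i = 1..n. G (B i))" for G :: "real \<Rightarrow> real"
      using sum_periodic_shift[of "\<lambda>x. G (g x - a j)" n "-k"] per by (simp add: a_def b_def A_def B_def)
    then have "(\<Sum>i = 1..n. (A i - B i) / 2 * (F (A i) - F ((A i + B i) / 2))) \<le> (\<Sum>i = 1..n. F (A i) * (A i - B i))"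
      by (intro rearrangement_gap F) auto
    moreover have "(A i + B i) / 2 = (a i + b i) / 2 - a j" "A i - B i = a i - b i" for i
      by (simp_all add: A_def B_def field_simps)
    ultimately show ?thesis by (simp only: T_def A_def[symmetric])
  qed
  have T0: "T i j \<ge> 0" for i j
  proof (cases "a i \<ge> b i")
    case True
    then have "F ((a i + b i) / 2 - a j) \<le> F (a i - a j)" by (intro monoD[OF F]) auto
    then show ?thesis using True by (simp add: T_def)
  next
    case False
    then have "F (a i - a j) \<le> F ((a i + b i) / 2 - a j)" by (intro monoD[OF F]) auto
    then show ?thesis using False by (simp add: T_def mult_nonpos_nonpos)
  qed
  have ab: "\<bar>a i - b i\<bar> \<le> L" for i
    unfolding a_def b_def by (rule periodic_lipschitz_oscillation[OF lip _ per]) (use L in simp)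
  \<comment> \<open>This radius makes \<open>\<bar>a i - a j\<bar> \<le> \<eta>/2\<close> on the
    window. The window holds at least \<open>r * n\<close> points, and \<open>r\<close> times the
    constant of \<open>monotone_pull\<close> is the constant claimed.\<close>
  define r where "r = \<eta> / (2 * L)"
  have r: "0 \<le> r" "r \<le> 1/2" "L * r = \<eta> / 2" using \<eta> L by (auto simp: r_def field_simps)
  have row: "c * \<eta>\<^sup>2 / (8 * L\<^sup>2) * real n * (a i - b i)\<^sup>2 \<le> (\<Sum>j = 1..n. T i j)" if i: "i \<in> {1..n}" for i
  proof -
    define J where "J = {j \<in> {1..n}. \<bar>real j / real n - real i / real n\<bar> \<le> r}"
    have TJ: "c * \<eta> / (4 * L) * (a i - b i)\<^sup>2 \<le> T i j" if "j \<in> J" for j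
    proof -
      have "\<bar>a i - a j\<bar> \<le> L * \<bar>real i / real n - real j / real n\<bar>" unfolding a_def by (rule lip)
      also have "\<dots> \<le> L * r" using that L by (intro mult_left_mono) (auto simp: J_def abs_minus_commute)
      finally have "\<bar>a i - a j\<bar> \<le> \<eta> / 2" using r by simp
      from monotone_pull[OF F c \<eta> growth this ab[of i]]
      have "c * \<eta> / (4 * L) * (a i - b i)\<^sup>2 \<le> (a i - b i) / 2 * (F (a i - a j) - F (a i - a j - (a i - b i) / 2))" by simp
      moreover have "a i - a j - (a i - b i) / 2 = (a i + b i) / 2 - a j" by (simp add: field_simps)
      ultimately show ?thesis by (simp add: T_def)
    qed
    have "c * \<eta>\<^sup>2 / (8 * L\<^sup>2) * real n * (a i - b i)\<^sup>2 = (r * real n) * (c * \<eta> / (4 * L) * (a i - b i)\<^sup>2)"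
      using L by (simp add: r_def power2_eq_square)
    also have "\<dots> \<le> real (card J) * (c * \<eta> / (4 * L) * (a i - b i)\<^sup>2)"
      unfolding J_def using i r c \<eta> L by (intro mult_right_mono card_grid_window) auto
    also have "\<dots> = (\<Sum>j\<in>J. c * \<eta> / (4 * L) * (a i - b i)\<^sup>2)" by simp
    also have "\<dots> \<le> (\<Sum>j\<in>J. T i j)" by (intro sum_mono TJ)
    also have "\<dots> \<le> (\<Sum>j = 1..n. T i j)" by (intro sum_mono2) (auto simp: J_def T0)
    finally show ?thesis .
  qed
  have "c * \<eta>\<^sup>2 / (8 * L\<^sup>2) * real n * (\<Sum>i = 1..n. (a i - b i)\<^sup>2) \<le> (\<Sum>i = 1..n. \<Sum>j = 1..n. T i j)"
    unfolding sum_distrib_left by (intro sum_mono row)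
  also have "\<dots> = (\<Sum>j = 1..n. \<Sum>i = 1..n. T i j)" by (rule sum.swap)
  also have "\<dots> \<le> (\<Sum>j = 1..n. \<Sum>i = 1..n. F (a i - a j) * (a i - b i))" by (intro sum_mono rearr)
  also have "\<dots> = (\<Sum>i = 1..n. \<Sum>j = 1..n. F (a i - a j) * (a i - b i))" by (rule sum.swap)
  finally show ?thesis by (simp add: a_def b_def)
qed

section \<open>Weighted control of increments\<close>

text \<open>The weights are summable with sum at most \<open>1/m\<close>, which replaces a peeling argument over dyadic
  blocks of \<open>k\<close>.\<close>
lemma weighted_increment_bound:
  fixes w :: "nat \<Rightarrow> real"
  assumes w0: "w 0 = 0" and m: "1 \<le> m" "m \<le> k" "k \<le> n"
  shows "(w k)\<^sup>2 \<le> 4 * (real k)^3 * (\<Sum>l<n. (w (Suc l) - w l)\<^sup>2 / (real (l + m) * real (l + m + 1)))"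
proof -
  define v where "v l = real (l + m) * real (l + m + 1)" for l
  have v0: "v l > 0" for l using m by (simp add: v_def)
  define d where "d l = w (Suc l) - w l" for l
  have "w k = (\<Sum>l<k. d l)" by (simp add: d_def sum_lessThan_telescope w0)
  \<comment> \<open>With the weights inserted, Cauchy-Schwarz puts all dependence on
    \<open>k\<close> into the sum of the weights; the other factor, extended to all
    \<open>l < n\<close>, is the same for every \<open>k\<close>.\<close>
  also have "\<dots> = (\<Sum>l<k. sqrt (v l) * (d l / sqrt (v l)))"
    using v0 by (intro sum.cong) (auto simp: less_imp_neq[symmetric])
  finally have "(w k)\<^sup>2 \<le> (\<Sum>l<k. (sqrt (v l))\<^sup>2) * (\<Sum>l<k. (d l / sqrt (v l))\<^sup>2)"
    using Cauchy_Schwarz_ineq_sum[of "\<lambda>l. sqrt (v l)" "\<lambda>l. d l / sqrt (v l)" "{..<k}"] by simp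
  also have "\<dots> = (\<Sum>l<k. v l) * (\<Sum>l<k. (d l)\<^sup>2 / v l)"
    using v0 by (simp add: power_divide less_imp_le)
  also have "\<dots> \<le> (4 * (real k)^3) * (\<Sum>l<n. (d l)\<^sup>2 / v l)"
  proof (intro mult_mono)
    have "v l \<le> (2 * real k) * (2 * real k)" if "l < k" for l
      unfolding v_def using that m by (intro mult_mono) auto
    then have "(\<Sum>l<k. v l) \<le> (\<Sum>l<k. (2 * real k) * (2 * real k))" by (intro sum_mono) auto
    then show "(\<Sum>l<k. v l) \<le> 4 * (real k)^3" by (simp add: power3_eq_cube)
    show "(\<Sum>l<k. (d l)\<^sup>2 / v l) \<le> (\<Sum>l<n. (d l)\<^sup>2 / v l)"
      using m v0 by (intro sum_mono2) (auto simp: less_imp_le)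
    show "0 \<le> (\<Sum>l<k. (d l)\<^sup>2 / v l)" using v0 by (intro sum_nonneg) (auto simp: less_imp_le)
  qed simp
  finally show ?thesis by (simp add: d_def v_def)
qed

lemma sum_inverse_consecutive_le:
  assumes "1 \<le> m"
  shows "(\<Sum>l<n. 1 / (real (l + m) * real (l + m + 1))) \<le> 1 / real m"
proof -
  have "(\<Sum>l<n. 1 / (real (l + m) * real (l + m + 1))) = (\<Sum>l<n. 1 / real (l + m) - 1 / real (Suc l + m))"
    using assms by (intro sum.cong) (auto simp: field_simps)
  also have "\<dots> = 1 / real m - 1 / real (n + m)"
    by (subst sum_lessThan_telescope') simp
  finally show ?thesis by simp
qed

section \<open>Second moment of the rank process\<close>

text \<open>In the expanded square only index pairs sharing an index contribute, each at most
  \<open>b^2\<close>. There are of order \<open>n^3\<close> of them, instead of all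
  \<open>n^4\<close>.\<close>

lemma (in prob_space) pair_statistic_second_moment:
  fixes B :: "'i \<Rightarrow> 'i \<Rightarrow> 'a \<Rightarrow> real" and e :: "'i \<Rightarrow> real"
  assumes I: "finite I"
    and meas: "\<And>i j. i \<in> I \<Longrightarrow> j \<in> I \<Longrightarrow> B i j \<in> borel_measurable M"
    and bound: "\<And>i j \<omega>. i \<in> I \<Longrightarrow> j \<in> I \<Longrightarrow> \<bar>B i j \<omega>\<bar> \<le> 1"
    and uncorr: "\<And>i j k l. i \<in> I \<Longrightarrow> j \<in> I \<Longrightarrow> k \<in> I \<Longrightarrow> l \<in> I \<Longrightarrow> {i, j} \<inter> {k, l} = {} \<Longrightarrow>
      expectation (\<lambda>\<omega>. B i j \<omega> * B k l \<omega>) = 0"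
    and e: "\<And>i. i \<in> I \<Longrightarrow> \<bar>e i\<bar> \<le> b"
  shows "expectation (\<lambda>\<omega>. (\<Sum>i\<in>I. \<Sum>j\<in>I. B i j \<omega> * e i)\<^sup>2) \<le> 4 * b\<^sup>2 * real (card I) ^ 3"
proof -
  define h where "h p \<omega> = B (fst p) (snd p) \<omega> * e (fst p)" for p \<omega>
  \<comment> \<open>The number of coincidences between two pairs: at least 1 when they overlap, and
    easy to sum exactly.\<close>
  define ov where "ov p q = (of_bool (fst q = fst p) + of_bool (fst q = snd p)
      + of_bool (snd q = fst p) + of_bool (snd q = snd p) :: real)" for p q :: "'i \<times> 'i"
  let ?P = "I \<times> I"
  have hm[measurable]: "h p \<in> borel_measurable M" if "p \<in> ?P" for p
    unfolding h_def using that meas by (auto intro!: borel_measurable_times)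
  have hb: "\<bar>h p \<omega>\<bar> \<le> b" if "p \<in> ?P" for p \<omega>
  proof -
    have "\<bar>B (fst p) (snd p) \<omega>\<bar> * \<bar>e (fst p)\<bar> \<le> 1 * b"
      using that by (intro mult_mono bound e) auto
    then show ?thesis by (simp add: h_def abs_mult)
  qed
  have hh: "\<bar>h p \<omega> * h q \<omega>\<bar> \<le> b\<^sup>2" if "p \<in> ?P" "q \<in> ?P" for p q \<omega>
    unfolding abs_mult power2_eq_square using hb[OF that(1)] hb[OF that(2)]
    by (intro mult_mono) (auto intro: order_trans[OF abs_ge_zero hb[OF that(1), of \<omega>]])
  have hint: "integrable M (\<lambda>\<omega>. h p \<omega> * h q \<omega>)" if "p \<in> ?P" "q \<in> ?P" for p q
    using hh[OF that] hm[OF that(1)] hm[OF that(2)]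
    by (intro integrable_const_bound[of _ "b\<^sup>2"]) auto
  have Ehh: "expectation (\<lambda>\<omega>. h p \<omega> * h q \<omega>) \<le> b\<^sup>2 * ov p q" if "p \<in> ?P" "q \<in> ?P" for p q
  proof (cases "{fst p, snd p} \<inter> {fst q, snd q} = {}")
    case True
    have "expectation (\<lambda>\<omega>. h p \<omega> * h q \<omega>)
        = expectation (\<lambda>\<omega>. (e (fst p) * e (fst q)) * (B (fst p) (snd p) \<omega> * B (fst q) (snd q) \<omega>))"
      by (simp add: h_def mult_ac)
    also have "\<dots> = 0" using uncorr[OF _ _ _ _ True] that by auto
    finally show ?thesis by (simp add: ov_def)
  next
    case False
    then have "1 \<le> ov p q" by (auto simp: ov_def)
    then have "b\<^sup>2 * 1 \<le> b\<^sup>2 * ov p q" by (intro mult_left_mono) auto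
    moreover have "expectation (\<lambda>\<omega>. h p \<omega> * h q \<omega>) \<le> expectation (\<lambda>\<omega>. b\<^sup>2)"
      using hh[OF that] by (intro integral_mono hint[OF that]) (auto simp: abs_le_iff)
    ultimately show ?thesis by (simp add: prob_space)
  qed
  have ov_sum: "(\<Sum>q\<in>?P. ov p q) = 4 * real (card I)" if "p \<in> ?P" for p
  proof -
    have 1: "(\<Sum>q\<in>?P. of_bool (fst q = x)) = real (card I)" if "x \<in> I" for x
    proof -
      have "(\<Sum>q\<in>?P. of_bool (fst q = x)) = (\<Sum>i\<in>I. \<Sum>j\<in>I. of_bool (i = x) :: real)"
        by (subst sum.cartesian_product) (auto simp: case_prod_beta)
      also have "\<dots> = real (card I)"
        using that I by (simp add: of_bool_def if_distrib sum_distrib_left[symmetric] cong: if_cong)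
      finally show ?thesis .
    qed
    have 2: "(\<Sum>q\<in>?P. of_bool (snd q = x)) = real (card I)" if "x \<in> I" for x
    proof -
      have "(\<Sum>q\<in>?P. of_bool (snd q = x)) = (\<Sum>i\<in>I. \<Sum>j\<in>I. of_bool (j = x) :: real)"
        by (subst sum.cartesian_product) (auto simp: case_prod_beta)
      also have "\<dots> = real (card I)"
        using that I by (simp add: of_bool_def if_distrib cong: if_cong)
      finally show ?thesis .
    qed
    show ?thesis using that by (auto simp: ov_def sum.distrib 1 2)
  qed
  have "expectation (\<lambda>\<omega>. (\<Sum>i\<in>I. \<Sum>j\<in>I. B i j \<omega> * e i)\<^sup>2) = expectation (\<lambda>\<omega>. \<Sum>p\<in>?P. \<Sum>q\<in>?P. h p \<omega> * h q \<omega>)"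
    by (simp add: h_def sum.cartesian_product case_prod_beta power2_eq_square sum_product)
  also have "\<dots> = (\<Sum>p\<in>?P. \<Sum>q\<in>?P. expectation (\<lambda>\<omega>. h p \<omega> * h q \<omega>))"
  proof -
    have "expectation (\<lambda>\<omega>. \<Sum>p\<in>?P. \<Sum>q\<in>?P. h p \<omega> * h q \<omega>) = (\<Sum>p\<in>?P. expectation (\<lambda>\<omega>. \<Sum>q\<in>?P. h p \<omega> * h q \<omega>))"
      by (intro Bochner_Integration.integral_sum Bochner_Integration.integrable_sum hint)
    also have "\<dots> = (\<Sum>p\<in>?P. \<Sum>q\<in>?P. expectation (\<lambda>\<omega>. h p \<omega> * h q \<omega>))"
      by (intro sum.cong refl Bochner_Integration.integral_sum hint)
    finally show ?thesis .
  qed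
  also have "\<dots> \<le> (\<Sum>p\<in>?P. \<Sum>q\<in>?P. b\<^sup>2 * ov p q)" by (intro sum_mono Ehh)
  also have "\<dots> = (\<Sum>p\<in>?P. b\<^sup>2 * (4 * real (card I)))"
    by (simp add: sum_distrib_left[symmetric] ov_sum)
  also have "\<dots> = 4 * b\<^sup>2 * real (card I) ^ 3" by (simp add: power3_eq_cube card_cartesian_product)
  finally show ?thesis .
qed

text \<open>The two centred comparisons are functions of disjoint groups of independent variables,
  so the expectation of the product factors into zeros.\<close>

lemma (in prob_space) disjoint_comparisons_uncorrelated:
  fixes Z :: "'i \<Rightarrow> 'a \<Rightarrow> real" and a :: "'i \<Rightarrow> real"
  assumes ind: "indep_vars (\<lambda>_. borel) Z I"
    and I: "i \<in> I" "j \<in> I" "k \<in> I" "l \<in> I" and disj: "{i, j} \<inter> {k, l} = {}"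
  shows "expectation (\<lambda>\<omega>. (of_bool (a j + Z j \<omega> \<le> a i + Z i \<omega>) - prob {\<omega> \<in> space M. a j + Z j \<omega> \<le> a i + Z i \<omega>})
    * (of_bool (a l + Z l \<omega> \<le> a k + Z k \<omega>) - prob {\<omega> \<in> space M. a l + Z l \<omega> \<le> a k + Z k \<omega>})) = 0"
proof -
  define p where "p i j = prob {\<omega> \<in> space M. a j + Z j \<omega> \<le> a i + Z i \<omega>}" for i j
  \<comment> \<open>\<open>H i j\<close> reads only the coordinates \<open>i\<close> and
    \<open>j\<close>, so it factors through the restriction of the family to
    \<open>{i, j}\<close>.\<close>
  define H where "H i j x = (of_bool (a j + x j \<le> a i + x i) - p i j :: real)" for i j and x :: "'i \<Rightarrow> real"
  have Hm: "H i j \<in> borel_measurable (PiM {i, j} (\<lambda>_. borel))" for i j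
  proof -
    have [measurable]: "(\<lambda>x. x i) \<in> borel_measurable (PiM {i, j} (\<lambda>_. borel :: real measure))"
      "(\<lambda>x. x j) \<in> borel_measurable (PiM {i, j} (\<lambda>_. borel :: real measure))" by measurable
    show ?thesis unfolding H_def of_bool_def by measurable
  qed
  have Zm: "Z i \<in> borel_measurable M" if "i \<in> I" for i
    using ind that by (auto simp: indep_vars_def)
  define X where "X i j \<omega> = H i j (\<lambda>i. Z i \<omega>)" for i j \<omega>
  have Xr: "X i j \<omega> = H i j (restrict (\<lambda>i. Z i \<omega>) {i, j})" for i j \<omega> by (simp add: X_def H_def)
  have Xint: "integrable M (X i j)" and XE: "expectation (X i j) = 0" if "i \<in> I" "j \<in> I" for i j
  proof -
    note [measurable] = Zm[OF that(1)] Zm[OF that(2)]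
    let ?A = "{\<omega> \<in> space M. a j + Z j \<omega> \<le> a i + Z i \<omega>}"
    have A: "?A \<in> sets M" by measurable
    have Xind: "X i j \<omega> = indicator ?A \<omega> - p i j" if "\<omega> \<in> space M" for \<omega>
      using that by (simp add: X_def H_def indicator_def)
    have int: "integrable M (\<lambda>\<omega>. indicator ?A \<omega> - p i j :: real)"
      using A by (intro Bochner_Integration.integrable_diff) (auto simp: emeasure_eq_measure)
    then show "integrable M (X i j)" using Xind by (simp cong: Bochner_Integration.integrable_cong)
    have "expectation (X i j) = expectation (\<lambda>\<omega>. indicator ?A \<omega> - p i j)"
      using Xind by (intro Bochner_Integration.integral_cong) auto
    also have "\<dots> = prob ?A - p i j"
      using A by (subst Bochner_Integration.integral_diff) (auto simp: emeasure_eq_measure prob_space)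
    finally show "expectation (X i j) = 0" by (simp add: p_def)
  qed
  have "indep_var borel (H i j \<circ> (\<lambda>\<omega>. restrict (\<lambda>i. Z i \<omega>) {i, j})) borel (H k l \<circ> (\<lambda>\<omega>. restrict (\<lambda>i. Z i \<omega>) {k, l}))"
    by (intro indep_var_compose[OF indep_var_restrict[OF ind disj]] Hm) (use I in auto)
  then have "indep_var borel (X i j) borel (X k l)" by (simp add: o_def Xr[symmetric])
  from indep_var_lebesgue_integral[OF this Xint Xint]
  have "expectation (\<lambda>\<omega>. X i j \<omega> * X k l \<omega>) = 0" using XE I by simp
  then show ?thesis by (simp add: X_def H_def p_def)
qed

section \<open>Distribution of a single comparison\<close>

lemma (in prob_space) prob_comparison:
  fixes Z :: "'i \<Rightarrow> 'a \<Rightarrow> real"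
  assumes ind: "indep_vars (\<lambda>_. borel) Z I" and I: "i \<in> I" "j \<in> I" "i \<noteq> j"
    and N: "distr M borel (Z i) = N" "distr M borel (Z j) = N"
  shows "prob {\<omega> \<in> space M. x + Z j \<omega> \<le> y + Z i \<omega>} = measure (N \<Otimes>\<^sub>M N) {p. snd p - fst p \<le> y - x}"
proof -
  have "indep_var borel (Z i) borel (Z j)"
  proof -
    have "indep_var borel ((\<lambda>x. x i) \<circ> (\<lambda>\<omega>. restrict (\<lambda>i. Z i \<omega>) {i})) borel ((\<lambda>x. x j) \<circ> (\<lambda>\<omega>. restrict (\<lambda>i. Z i \<omega>) {j}))"
      by (intro indep_var_compose[OF indep_var_restrict[OF ind]] measurable_component_singleton) (use I in auto)
    then show ?thesis by (simp add: o_def)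
  qed
  then have rv: "random_variable borel (Z i)" "random_variable borel (Z j)"
    and d: "N \<Otimes>\<^sub>M N = distr M (borel \<Otimes>\<^sub>M borel) (\<lambda>\<omega>. (Z i \<omega>, Z j \<omega>))"
    unfolding indep_var_distribution_eq N by auto
  note [measurable] = rv
  have "{p \<in> space (borel \<Otimes>\<^sub>M borel). snd p - fst p \<le> y - x} \<in> sets (borel \<Otimes>\<^sub>M (borel :: real measure))"
    by measurable
  then have "measure (N \<Otimes>\<^sub>M N) {p. snd p - fst p \<le> y - x}
      = prob ((\<lambda>\<omega>. (Z i \<omega>, Z j \<omega>)) -` {p. snd p - fst p \<le> y - x} \<inter> space M)"
    unfolding d by (subst measure_distr) (auto simp: space_pair_measure)
  also have "(\<lambda>\<omega>. (Z i \<omega>, Z j \<omega>)) -` {p. snd p - fst p \<le> y - x} \<inter> space M = {\<omega> \<in> space M. x + Z j \<omega> \<le> y + Z i \<omega>}"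
    by (auto simp: algebra_simps)
  finally show ?thesis by simp
qed

text \<open>Collects the two properties of the distribution function of the difference on which the
  drift rests.\<close>

lemma difference_cdf_mono_growth:
  fixes \<phi> :: "real \<Rightarrow> real"
  defines "N \<equiv> density lborel (\<lambda>z. ennreal (\<phi> z))"
  defines "F \<equiv> \<lambda>u. measure (N \<Otimes>\<^sub>M N) {p. snd p - fst p \<le> u}"
  assumes \<phi>: "\<phi> \<in> borel_measurable borel" and P: "prob_space N"
  shows "mono F"
    and "\<exists>c>0. \<exists>\<eta>>0. \<forall>u v. -\<eta> \<le> v \<longrightarrow> v \<le> u \<longrightarrow> u \<le> \<eta> \<longrightarrow> c * (u - v) \<le> F u - F v"
proof -
  interpret N: prob_space N by fact
  interpret NN: pair_prob_space N N ..
  have sN[measurable_cong]: "sets N = sets borel" by (simp add: N_def)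
  have A: "{p. snd p - fst p \<le> u} \<in> sets (N \<Otimes>\<^sub>M N)" for u
  proof -
    have "{p \<in> space (borel \<Otimes>\<^sub>M borel). snd p - fst p \<le> u} \<in> sets (borel \<Otimes>\<^sub>M (borel :: real measure))"
      by measurable
    then show ?thesis by (simp add: space_pair_measure cong: sets_pair_measure_cong[OF sN sN])
  qed
  show "mono F" unfolding F_def by (intro monoI NN.finite_measure_mono A) auto
  have diff: "F u - F v = measure (N \<Otimes>\<^sub>M N) {p. v < snd p - fst p \<and> snd p - fst p \<le> u}" if "v \<le> u" for u v
  proof -
    have "{p :: real \<times> real. v < snd p - fst p \<and> snd p - fst p \<le> u} = {p. snd p - fst p \<le> u} - {p. snd p - fst p \<le> v}"
      by auto
    then show ?thesis
      unfolding F_def using that by (simp add: NN.finite_measure_Diff A subset_iff)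
  qed
  obtain c \<eta> where c: "c > 0" and \<eta>: "\<eta> > 0"
    and growth: "\<And>u v. -\<eta> \<le> v \<Longrightarrow> v \<le> u \<Longrightarrow> u \<le> \<eta> \<Longrightarrow>
      c * (u - v) \<le> measure (N \<Otimes>\<^sub>M N) {p. v < snd p - fst p \<and> snd p - fst p \<le> u}"
    using difference_mass_near_zero[OF \<phi> P[unfolded N_def]] unfolding N_def by blast
  have "\<forall>u v. -\<eta> \<le> v \<longrightarrow> v \<le> u \<longrightarrow> u \<le> \<eta> \<longrightarrow> c * (u - v) \<le> F u - F v"
    using growth by (simp add: diff)
  then show "\<exists>c>0. \<exists>\<eta>>0. \<forall>u v. -\<eta> \<le> v \<longrightarrow> v \<le> u \<longrightarrow> u \<le> \<eta> \<longrightarrow> c * (u - v) \<le> F u - F v"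
    using c \<eta> by (intro exI[of _ c] exI[of _ \<eta>] conjI)
qed

section \<open>Rounding to the grid\<close>

lemma dist_mod1_le: "dist_mod1 a b \<le> \<bar>a - b - of_int k\<bar>"
  unfolding dist_mod1_def by (intro cINF_lower bdd_belowI2[of _ 0]) auto

text \<open>The shift is reduced to \<open>s\<close> in \<open>[-1/2, 1/2]\<close> and rounded
  towards 0, which keeps \<open>2 * k \<le> n\<close>. The sign is kept apart as \<sigma>, so that
  the two directions can be treated alike with a natural \<open>k\<close>.\<close>

lemma round_shift_to_grid:
  fixes g :: "real \<Rightarrow> real"
  assumes lip: "\<And>x y. \<bar>g x - g y\<bar> \<le> L * \<bar>x - y\<bar>" and L: "L \<ge> 0"
    and per: "\<And>x. g (x + 1) = g x" and n: "n \<ge> 1"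
  shows "\<exists>k::nat. \<exists>\<sigma>::int. (\<sigma> = 1 \<or> \<sigma> = -1) \<and> 2 * k \<le> n \<and> dist_mod1 a b \<le> (real k + 1) / real n \<and>
    (\<forall>x. \<bar>g (x - (a - b)) - g (x - of_int (\<sigma> * int k) / real n)\<bar> \<le> L / real n)"
proof -
  define p where "p = \<lfloor>a - b + 1/2\<rfloor>"
  define s where "s = a - b - of_int p"
  have s: "\<bar>s\<bar> \<le> 1/2" unfolding s_def p_def by linarith
  define \<sigma> :: int where "\<sigma> = (if s \<ge> 0 then 1 else -1)"
  have \<sigma>: "\<sigma> = 1 \<or> \<sigma> = -1" by (simp add: \<sigma>_def)
  define k where "k = nat \<lfloor>real n * \<bar>s\<bar>\<rfloor>"
  have "0 \<le> real n * \<bar>s\<bar>" by simp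
  then have "int k = \<lfloor>real n * \<bar>s\<bar>\<rfloor>" unfolding k_def by simp
  then have k: "real k \<le> real n * \<bar>s\<bar>" "real n * \<bar>s\<bar> < real k + 1" by linarith+
  have "real n * \<bar>s\<bar> \<le> real n * (1/2)" using s by (intro mult_left_mono) auto
  then have "real (2 * k) \<le> real n" using k(1) by simp
  then have k2: "2 * k \<le> n" by (simp only: of_nat_le_iff)
  have n0: "real n > 0" using n by simp
  have d: "dist_mod1 a b \<le> (real k + 1) / real n"
  proof -
    have "dist_mod1 a b \<le> \<bar>s\<bar>" unfolding s_def by (rule dist_mod1_le)
    also have "\<dots> \<le> (real k + 1) / real n" using k(2) n0 by (simp add: field_simps)
    finally show ?thesis .
  qed
  have "\<bar>g (x - (a - b)) - g (x - of_int (\<sigma> * int k) / real n)\<bar> \<le> L / real n" for x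
  proof -
    have "g (x - (a - b)) = g (x - s)"
      using periodic_of_int[of g, OF per, of "x - s" "-p"] by (simp add: s_def algebra_simps)
    moreover have "\<bar>(x - s) - (x - of_int (\<sigma> * int k) / real n)\<bar> \<le> 1 / real n"
    proof -
      have "s = of_int \<sigma> * \<bar>s\<bar>" by (simp add: \<sigma>_def)
      then have "(x - s) - (x - of_int (\<sigma> * int k) / real n) = of_int \<sigma> * ((real k - real n * \<bar>s\<bar>) / real n)"
        using n0 by (simp add: field_simps)
      moreover have "\<bar>of_int \<sigma> :: real\<bar> = 1" using \<sigma> by auto
      moreover have "\<bar>real k - real n * \<bar>s\<bar>\<bar> \<le> 1" using k by simp
      ultimately show ?thesis using n0 by (simp add: abs_mult abs_divide divide_right_mono)
    qed
    then have "L * \<bar>(x - s) - (x - of_int (\<sigma> * int k) / real n)\<bar> \<le> L * (1 / real n)"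
      using L by (rule mult_left_mono)
    ultimately show ?thesis using lip[of "x - s" "x - of_int (\<sigma> * int k) / real n"] by simp
  qed
  then show ?thesis using \<sigma> k2 d by (intro exI[of _ k] exI[of _ \<sigma>] conjI allI)
qed

section \<open>The noise process and its tail\<close>

text \<open>The rank objective at the true shift minus that at the shift by \<open>k/n\<close>, with
  every comparison centred at its own probability. The diagonal terms \<open>i = j\<close> therefore
  vanish.\<close>

definition (in prob_space) rank_noise :: "(nat \<Rightarrow> 'a \<Rightarrow> real) \<Rightarrow> (real \<Rightarrow> real) \<Rightarrow> nat \<Rightarrow> int \<Rightarrow> 'a \<Rightarrow> real" where
  "rank_noise Z g n k \<omega> = (\<Sum>i = 1..n. \<Sum>j = 1..n.
     (of_bool (g (real j / real n) + Z j \<omega> \<le> g (real i / real n) + Z i \<omega>)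
       - prob {\<omega> \<in> space M. g (real j / real n) + Z j \<omega> \<le> g (real i / real n) + Z i \<omega>})
     * (g (real i / real n) - g (real i / real n - of_int k / real n))) / (real n)\<^sup>2"

context prob_space
begin

context
  fixes Z :: "nat \<Rightarrow> 'a \<Rightarrow> real" and g :: "real \<Rightarrow> real" and L :: real and n :: nat
  assumes ind: "indep_vars (\<lambda>_. borel) Z {1..}"
    and lip: "\<And>x y. \<bar>g x - g y\<bar> \<le> L * \<bar>x - y\<bar>"
    and n: "n \<ge> 1"
begin

lemma rank_noise_measurable [measurable]: "rank_noise Z g n k \<in> borel_measurable M"
proof -
  have [measurable]: "Z i \<in> borel_measurable M" if "i \<in> {1..n}" for i
    using ind that by (auto simp: indep_vars_def)
  show ?thesis unfolding rank_noise_def of_bool_def by measurable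
qed

text \<open>Neighbouring shifts change the coefficients by at most \<open>L/n\<close>. The pair
  statistic then has second moment at most \<open>4 * (L/n)^2 * n^3\<close>, and the normalisation
  divides it by \<open>n^4\<close>.\<close>

lemma rank_noise_increment:
  assumes kk: "\<bar>k' - k\<bar> = 1"
  shows "integrable M (\<lambda>\<omega>. (rank_noise Z g n k' \<omega> - rank_noise Z g n k \<omega>)\<^sup>2)"
    and "expectation (\<lambda>\<omega>. (rank_noise Z g n k' \<omega> - rank_noise Z g n k \<omega>)\<^sup>2) \<le> 4 * L\<^sup>2 / real n ^ 3"
proof -
  define a where "a i = g (real i / real n)" for i
  define B where "B i j \<omega> = (of_bool (a j + Z j \<omega> \<le> a i + Z i \<omega>)
    - prob {\<omega> \<in> space M. a j + Z j \<omega> \<le> a i + Z i \<omega>} :: real)" for i j \<omega>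
  define e where "e i = g (real i / real n - of_int k / real n) - g (real i / real n - of_int k' / real n)" for i
  have n0: "real n > 0" using n by simp
  have diff: "rank_noise Z g n k' \<omega> - rank_noise Z g n k \<omega> = (\<Sum>i = 1..n. \<Sum>j = 1..n. B i j \<omega> * e i) / (real n)\<^sup>2" for \<omega>
  proof -
    let ?d = "\<lambda>k i. a i - g (real i / real n - of_int k / real n)"
    have "(\<Sum>i = 1..n. \<Sum>j = 1..n. B i j \<omega> * e i) = (\<Sum>i = 1..n. \<Sum>j = 1..n. B i j \<omega> * ?d k' i - B i j \<omega> * ?d k i)"
      by (intro sum.cong refl) (simp add: e_def algebra_simps)
    then show ?thesis
      by (simp only: rank_noise_def B_def a_def sum_subtractf diff_divide_distrib)
  qed
  have eb: "\<bar>e i\<bar> \<le> L / real n" for i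
  proof -
    have "k' = k + 1 \<or> k' = k - 1" using kk by linarith
    then have "\<bar>of_int k' - of_int k :: real\<bar> = 1" by auto
    moreover have "(real i / real n - of_int k / real n) - (real i / real n - of_int k' / real n) = (of_int k' - of_int k) / real n"
      by (simp add: diff_divide_distrib)
    ultimately have "\<bar>(real i / real n - of_int k / real n) - (real i / real n - of_int k' / real n)\<bar> = 1 / real n"
      by (simp only: abs_divide abs_of_nat)
    then show ?thesis
      using lip[of "real i / real n - of_int k / real n" "real i / real n - of_int k' / real n"]
      by (simp only: e_def) simp
  qed
  have Bm: "B i j \<in> borel_measurable M" if "i \<in> {1..n}" "j \<in> {1..n}" for i j
  proof -
    have [measurable]: "Z i \<in> borel_measurable M" "Z j \<in> borel_measurable M"
      using ind that by (auto simp: indep_vars_def)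
    show ?thesis unfolding B_def of_bool_def by measurable
  qed
  have Bb: "\<bar>B i j \<omega>\<bar> \<le> 1" for i j \<omega>
    using measure_nonneg[of M "{\<omega> \<in> space M. a j + Z j \<omega> \<le> a i + Z i \<omega>}"]
      prob_le_1[of "{\<omega> \<in> space M. a j + Z j \<omega> \<le> a i + Z i \<omega>}"] by (auto simp: B_def)
  have b0: "0 \<le> L / real n" using order_trans[OF abs_ge_zero eb[of 0]] .
  have Sb: "\<bar>\<Sum>i = 1..n. \<Sum>j = 1..n. B i j \<omega> * e i\<bar> \<le> (real n)\<^sup>2 * (L / real n)" for \<omega>
  proof -
    have "\<bar>\<Sum>i = 1..n. \<Sum>j = 1..n. B i j \<omega> * e i\<bar> \<le> (\<Sum>i = 1..n. \<Sum>j = 1..n. \<bar>B i j \<omega> * e i\<bar>)"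
      by (intro order_trans[OF sum_abs] sum_mono sum_abs)
    also have "\<dots> \<le> (\<Sum>i = 1..n. \<Sum>j = 1..n. 1 * (L / real n))"
      unfolding abs_mult by (intro sum_mono mult_mono Bb eb) auto
    also have "\<dots> = (real n)\<^sup>2 * (L / real n)" by (simp add: power2_eq_square)
    finally show ?thesis .
  qed
  have "\<bar>rank_noise Z g n k' \<omega> - rank_noise Z g n k \<omega>\<bar> \<le> L / real n" for \<omega>
    unfolding diff using Sb[of \<omega>] n0 by (simp add: abs_divide divide_le_eq mult.commute)
  then have "(rank_noise Z g n k' \<omega> - rank_noise Z g n k \<omega>)\<^sup>2 \<le> (L / real n)\<^sup>2" for \<omega>
    using b0 by (metis abs_le_square_iff abs_of_nonneg)
  then show "integrable M (\<lambda>\<omega>. (rank_noise Z g n k' \<omega> - rank_noise Z g n k \<omega>)\<^sup>2)"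
    by (intro integrable_const_bound[of _ "(L / real n)\<^sup>2"]) auto
  have "expectation (\<lambda>\<omega>. (\<Sum>i = 1..n. \<Sum>j = 1..n. B i j \<omega> * e i)\<^sup>2) \<le> 4 * (L / real n)\<^sup>2 * real (card {1..n}) ^ 3"
  proof (intro pair_statistic_second_moment Bm Bb eb)
    fix i j k l assume "i \<in> {1..n}" "j \<in> {1..n}" "k \<in> {1..n}" "l \<in> {1..n}" "{i, j} \<inter> {k, l} = {}"
    then show "expectation (\<lambda>\<omega>. B i j \<omega> * B k l \<omega>) = 0"
      unfolding B_def by (intro disjoint_comparisons_uncorrelated[OF ind]) auto
  qed auto
  then have E: "expectation (\<lambda>\<omega>. (\<Sum>i = 1..n. \<Sum>j = 1..n. B i j \<omega> * e i)\<^sup>2) \<le> 4 * L\<^sup>2 * real n"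
    using n0 by (simp add: power_divide power2_eq_square power3_eq_cube)
  have "expectation (\<lambda>\<omega>. (rank_noise Z g n k' \<omega> - rank_noise Z g n k \<omega>)\<^sup>2)
      = expectation (\<lambda>\<omega>. (\<Sum>i = 1..n. \<Sum>j = 1..n. B i j \<omega> * e i)\<^sup>2) / real n ^ 4"
    unfolding diff by (simp add: power_divide)
  also have "\<dots> \<le> 4 * L\<^sup>2 * real n / real n ^ 4" using E by (intro divide_right_mono) auto
  also have "\<dots> = 4 * L\<^sup>2 / real n ^ 3" using n0 by (simp add: eval_nat_numeral)
  finally show "expectation (\<lambda>\<omega>. (rank_noise Z g n k' \<omega> - rank_noise Z g n k \<omega>)\<^sup>2) \<le> 4 * L\<^sup>2 / real n ^ 3" .
qed

text \<open>Markov's inequality for the weighted sum of squared increments. The event it controls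
  handles all \<open>k \<ge> m\<close> in the direction \<sigma> at once.\<close>

lemma rank_noise_weighted_tail:
  fixes \<sigma> :: int and m :: nat and t :: real
  defines "Q \<equiv> \<lambda>\<omega>. \<Sum>l<n. (rank_noise Z g n (\<sigma> * int (Suc l)) \<omega> - rank_noise Z g n (\<sigma> * int l) \<omega>)\<^sup>2
      / (real (l + m) * real (l + m + 1))"
  assumes \<sigma>: "\<sigma> = 1 \<or> \<sigma> = -1" and m: "1 \<le> m" and t: "t > 0"
  shows "{\<omega> \<in> space M. t \<le> Q \<omega>} \<in> events"
    and "prob {\<omega> \<in> space M. t \<le> Q \<omega>} \<le> 4 * L\<^sup>2 / (real n ^ 3 * real m * t)"
proof -
  have kk: "\<bar>\<sigma> * int (Suc l) - \<sigma> * int l\<bar> = 1" for l using \<sigma> by (auto simp: algebra_simps)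
  note inc = rank_noise_increment[OF kk]
  show "{\<omega> \<in> space M. t \<le> Q \<omega>} \<in> events" unfolding Q_def by measurable
  have Qint: "integrable M Q"
    unfolding Q_def by (intro Bochner_Integration.integrable_sum integrable_divide inc)
  have "expectation Q = (\<Sum>l<n. expectation (\<lambda>\<omega>. (rank_noise Z g n (\<sigma> * int (Suc l)) \<omega> - rank_noise Z g n (\<sigma> * int l) \<omega>)\<^sup>2)
      / (real (l + m) * real (l + m + 1)))"
    unfolding Q_def by (subst Bochner_Integration.integral_sum) (auto intro!: integrable_divide inc simp del: of_nat_Suc)
  also have "\<dots> \<le> (\<Sum>l<n. (4 * L\<^sup>2 / real n ^ 3) / (real (l + m) * real (l + m + 1)))"
    by (intro sum_mono divide_right_mono inc) auto
  also have "\<dots> = (4 * L\<^sup>2 / real n ^ 3) * (\<Sum>l<n. 1 / (real (l + m) * real (l + m + 1)))"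
    by (simp add: sum_distrib_left)
  also have "\<dots> \<le> (4 * L\<^sup>2 / real n ^ 3) * (1 / real m)"
    by (intro mult_left_mono sum_inverse_consecutive_le m) auto
  finally have EQ: "expectation Q \<le> (4 * L\<^sup>2 / real n ^ 3) * (1 / real m)" .
  have "prob {\<omega> \<in> space M. t \<le> Q \<omega>} \<le> expectation Q / t"
    by (rule integral_Markov_inequality_measure[OF Qint, of "{}"]) (use t in \<open>auto simp: Q_def intro!: sum_nonneg\<close>)
  also have "\<dots> \<le> (4 * L\<^sup>2 / real n ^ 3) * (1 / real m) / t" using EQ t by (intro divide_right_mono) auto
  finally show "prob {\<omega> \<in> space M. t \<le> Q \<omega>} \<le> 4 * L\<^sup>2 / (real n ^ 3 * real m * t)"
    by (simp add: mult_ac)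
qed

end

end

section \<open>Consistency\<close>

lemma rank_of_eq_sum: "real (rank_of Y n i) = (\<Sum>j = 1..n. of_bool (Y j \<le> Y i))"
  by (simp add: rank_of_def of_bool_def sum.If_cases Int_def)

text \<open>A rank is a sum of comparisons; splitting each into its centred part and its probability
  separates noise from drift.\<close>

lemma (in prob_space) rank_objective_decomposition:
  fixes Z :: "nat \<Rightarrow> 'a \<Rightarrow> real" and g :: "real \<Rightarrow> real" and k :: int
  assumes ind: "indep_vars (\<lambda>_. borel) Z {1..}"
    and N: "\<And>i. i \<ge> 1 \<Longrightarrow> distr M borel (Z i) = N"
    and per: "\<And>x. g (x + 1) = g x"
  shows "(\<Sum>i = 1..n. real (rank_of (\<lambda>i. g (real i / real n) + Z i \<omega>) n i) / real n
        * (g (real i / real n) - g (real i / real n - of_int k / real n))) / real n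
    = rank_noise Z g n k \<omega> + (\<Sum>i = 1..n. \<Sum>j = 1..n.
        measure (N \<Otimes>\<^sub>M N) {p. snd p - fst p \<le> g (real i / real n) - g (real j / real n)}
        * (g (real i / real n) - g (real i / real n - of_int k / real n))) / (real n)\<^sup>2"
proof -
  define a where "a i = g (real i / real n)" for i
  define D where "D i = a i - g (real i / real n - of_int k / real n)" for i
  define F where "F u = measure (N \<Otimes>\<^sub>M N) {p. snd p - fst p \<le> u}" for u
  define q where "q i j = prob {\<omega> \<in> space M. a j + Z j \<omega> \<le> a i + Z i \<omega>}" for i j
  define cmp where "cmp i j = (of_bool (a j + Z j \<omega> \<le> a i + Z i \<omega>) :: real)" for i j
  \<comment> \<open>so the diagonal comparisons \<open>j = i\<close>, which have probability \<open>1\<close> instead of \<open>F 0\<close>, drop out\<close>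
  have D0: "(\<Sum>i = 1..n. D i) = 0"
    using sum_periodic_shift[of g n "-k", OF per] by (simp add: D_def a_def sum_subtractf)
  have q: "q i j = F (a i - a j) + of_bool (j = i) * (1 - F 0)" if "i \<in> {1..n}" "j \<in> {1..n}" for i j
  proof (cases "j = i")
    case True
    then show ?thesis by (simp add: q_def prob_space)
  next
    case False
    then have "q i j = F (a i - a j)"
      unfolding q_def F_def using that by (intro prob_comparison[OF ind]) (auto intro: N)
    then show ?thesis using False by simp
  qed
  have "(\<Sum>i = 1..n. \<Sum>j = 1..n. q i j * D i)
      = (\<Sum>i = 1..n. \<Sum>j = 1..n. F (a i - a j) * D i + (if j = i then (1 - F 0) * D i else 0))"
    by (intro sum.cong refl) (auto simp: q algebra_simps)
  also have "\<dots> = (\<Sum>i = 1..n. (\<Sum>j = 1..n. F (a i - a j) * D i) + (1 - F 0) * D i)"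
    by (intro sum.cong refl) (simp add: sum.distrib)
  also have "\<dots> = (\<Sum>i = 1..n. \<Sum>j = 1..n. F (a i - a j) * D i) + (1 - F 0) * (\<Sum>i = 1..n. D i)"
    by (simp add: sum.distrib sum_distrib_left)
  finally have pop: "(\<Sum>i = 1..n. \<Sum>j = 1..n. q i j * D i) = (\<Sum>i = 1..n. \<Sum>j = 1..n. F (a i - a j) * D i)"
    using D0 by simp
  have "(\<Sum>i = 1..n. real (rank_of (\<lambda>i. a i + Z i \<omega>) n i) / real n * D i) / real n
      = (\<Sum>i = 1..n. \<Sum>j = 1..n. cmp i j * D i) / (real n)\<^sup>2"
    by (simp add: rank_of_eq_sum cmp_def sum_divide_distrib sum_distrib_right power2_eq_square)
  also have "(\<Sum>i = 1..n. \<Sum>j = 1..n. cmp i j * D i)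
      = (\<Sum>i = 1..n. \<Sum>j = 1..n. (cmp i j - q i j) * D i) + (\<Sum>i = 1..n. \<Sum>j = 1..n. q i j * D i)"
    by (simp add: sum.distrib[symmetric] algebra_simps)
  also have "\<dots> / (real n)\<^sup>2 = rank_noise Z g n k \<omega> + (\<Sum>i = 1..n. \<Sum>j = 1..n. F (a i - a j) * D i) / (real n)\<^sup>2"
    unfolding pop rank_noise_def by (simp add: cmp_def q_def a_def D_def add_divide_distrib)
  finally show ?thesis by (simp add: a_def D_def F_def)
qed

text \<open>Maximality forces the noise to outweigh the drift at the rounded estimate. If the
  estimate is far off, this makes a weighted sum of squared increments large, which is
  improbable.\<close>

lemma (in prob_space) rank_estimator_sqrt_consistent:
  fixes Z :: "nat \<Rightarrow> 'a \<Rightarrow> real" and g :: "real \<Rightarrow> real" and \<theta>hat :: "nat \<Rightarrow> 'a \<Rightarrow> real"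
  defines "Y \<equiv> \<lambda>n \<omega> i. g (real i / real n) + Z i \<omega>"
  assumes ind: "indep_vars (\<lambda>_. borel) Z {1..}"
    and N: "\<And>i. i \<ge> 1 \<Longrightarrow> distr M borel (Z i) = density lborel (\<lambda>z. ennreal (\<phi> z))"
    and \<phi>: "\<phi> \<in> borel_measurable borel"
    and lip: "\<And>x y. \<bar>g x - g y\<bar> \<le> L * \<bar>x - y\<bar>" and L: "L > 0"
    and per: "\<And>x. g (x + 1) = g x"
    and exact: "\<And>t. 1/4 \<le> t \<Longrightarrow> t \<le> 1/2 \<Longrightarrow> \<exists>x. g x \<noteq> g (x - t)"
    and max: "\<And>n \<omega>. n \<ge> 1 \<Longrightarrow> \<omega> \<in> space M \<Longrightarrow>
      (\<Sum>i = 1..n. real (rank_of (Y n \<omega>) n i) / real n * g (real i / real n))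
      \<le> (\<Sum>i = 1..n. real (rank_of (Y n \<omega>) n i) / real n * g (real i / real n - (\<theta>hat n \<omega> - \<theta>)))"
    and eps: "(eps::real) > 0"
  shows "\<exists>K. \<forall>n\<ge>1. prob {\<omega> \<in> space M. sqrt (real n) * dist_mod1 (\<theta>hat n \<omega>) \<theta> > K} < eps"
proof -
  let ?N = "density lborel (\<lambda>z. ennreal (\<phi> z))"
  have "random_variable borel (Z 1)" using ind by (auto simp: indep_vars_def)
  then have PN: "prob_space ?N" using prob_space_distr N[of 1] by (metis order_refl)
  define F where "F u = measure (?N \<Otimes>\<^sub>M ?N) {p. snd p - fst p \<le> u}" for u
  have F: "mono F" using difference_cdf_mono_growth(1)[OF \<phi> PN] unfolding F_def .
  obtain c \<eta>0 where c: "c > 0" and \<eta>0: "\<eta>0 > 0"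
    "\<And>u v. -\<eta>0 \<le> v \<Longrightarrow> v \<le> u \<Longrightarrow> u \<le> \<eta>0 \<Longrightarrow> c * (u - v) \<le> F u - F v"
    using difference_cdf_mono_growth(2)[OF \<phi> PN] unfolding F_def by blast
  define \<eta> where "\<eta> = min \<eta>0 L"
  have \<eta>: "0 < \<eta>" "\<eta> \<le> L" using \<eta>0(1) L by (auto simp: \<eta>_def)
  have growth: "c * (u - v) \<le> F u - F v" if "-\<eta> \<le> v" "v \<le> u" "u \<le> \<eta>" for u v
    using \<eta>0(2)[of v u] that by (auto simp: \<eta>_def)
  have "L-lipschitz_on UNIV g" using lip L by (intro lipschitz_onI) (auto simp: dist_real_def)
  then have cont: "continuous_on UNIV g" by (rule lipschitz_on_continuous_on)
  obtain \<epsilon> where "\<epsilon> > 0" "\<And>t. t \<in> {1/4..1/2} \<Longrightarrow> \<exists>x. \<bar>g x - g (x - t)\<bar> \<ge> \<epsilon>"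
    by (rule uniform_shift_separation[OF cont compact_Icc, of "1/4" "1/2"]) (use exact in auto)
  then have \<epsilon>: "\<epsilon> > 0" "\<And>t. 1/4 \<le> t \<Longrightarrow> t \<le> 1/2 \<Longrightarrow> \<exists>x. \<bar>g x - g (x - t)\<bar> \<ge> \<epsilon>"
    by auto
  obtain c' where c': "c' > 0"
    "\<And>n k. real n \<ge> 4 * L / \<epsilon> \<Longrightarrow> 1 \<le> k \<Longrightarrow> 2 * k \<le> n \<Longrightarrow>
      c' * (real k / real n)\<^sup>2 \<le> (\<Sum>i = 1..n. (g (real i / real n) - g (real i / real n - real k / real n))\<^sup>2) / real n"
    by (rule shift_energy_quadratic_growth[of g L \<epsilon>]) (use lip L per \<epsilon> that in blast)+
  define C where "C = c * \<eta>\<^sup>2 / (8 * L\<^sup>2) * c'"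
  have C: "C > 0" using c \<eta> L c' by (simp add: C_def)
  have drift: "C * (real k / real n)\<^sup>2 \<le> (\<Sum>i = 1..n. \<Sum>j = 1..n. F (g (real i / real n) - g (real j / real n))
      * (g (real i / real n) - g (real i / real n - of_int (\<sigma> * int k) / real n))) / (real n)\<^sup>2"
    if n: "real n \<ge> 4 * L / \<epsilon>" "1 \<le> k" "2 * k \<le> n" and \<sigma>: "\<sigma> = 1 \<or> \<sigma> = -1" for n k and \<sigma> :: int
  proof -
    have n0: "real n > 0" using n by simp
    let ?E = "\<lambda>k. \<Sum>i = 1..n. (g (real i / real n) - g (real i / real n - of_int k / real n))\<^sup>2"
    \<comment> \<open>Moving all sample points by \<open>k/n\<close> exchanges the two values being
      compared, so a backward shift has the energy of the forward one.\<close>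
    have "?E (\<sigma> * int k) = ?E (int k)"
    proof -
      let ?u = "\<lambda>x. (g x - g (x - of_int (int k) / real n))\<^sup>2"
      have "?u (x + 1) = ?u x" for x
        using per[of x] per[of "x - of_int (int k) / real n"] by (simp add: algebra_simps)
      from sum_periodic_shift[of ?u n "int k", OF this] \<sigma> show ?thesis
        by (auto simp: power2_commute)
    qed
    then have E: "c' * (real k / real n)\<^sup>2 \<le> ?E (\<sigma> * int k) / real n"
      using c'(2)[OF n] by simp
    have "C * (real k / real n)\<^sup>2 = c * \<eta>\<^sup>2 / (8 * L\<^sup>2) * (c' * (real k / real n)\<^sup>2)"
      by (simp add: C_def)
    also have "\<dots> \<le> c * \<eta>\<^sup>2 / (8 * L\<^sup>2) * (?E (\<sigma> * int k) / real n)"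
      using c by (intro mult_left_mono E) auto
    also have "\<dots> = (c * \<eta>\<^sup>2 / (8 * L\<^sup>2) * real n * ?E (\<sigma> * int k)) / (real n)\<^sup>2"
      using n0 by (simp add: power2_eq_square)
    also have "\<dots> \<le> (\<Sum>i = 1..n. \<Sum>j = 1..n. F (g (real i / real n) - g (real j / real n))
      * (g (real i / real n) - g (real i / real n - of_int (\<sigma> * int k) / real n))) / (real n)\<^sup>2"
      by (intro divide_right_mono population_drift[OF F c \<eta> growth lip per]) auto
    finally show ?thesis .
  qed
  define W where "W n = rank_noise Z g n" for n
  define Q where "Q n m \<sigma> \<omega> = (\<Sum>l<n. (W n (\<sigma> * int (Suc l)) \<omega> - W n (\<sigma> * int l) \<omega>)\<^sup>2
      / (real (l + m) * real (l + m + 1)))" for n m \<omega> and \<sigma> :: int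
  \<comment> \<open>The threshold comes from \<open>C/2 * (k/n)^2 \<le> \<bar>W\<bar>\<close> and
    \<open>W^2 \<le> 4 * k^3 * Q\<close>, which give \<open>Q \<ge> C^2 * k / (16 * n^4)\<close>;
    then \<open>m \<le> k\<close>.\<close>
  have large: "\<exists>\<sigma>\<in>{1,-1}. C\<^sup>2 * real m / (16 * real n ^ 4) \<le> Q n m \<sigma> \<omega>"
    if n: "n \<ge> 1" "real n \<ge> 4 * L / \<epsilon>" and m: "1 \<le> m" "2 * L / real n \<le> C * (real m / real n)\<^sup>2"
      and \<omega>: "\<omega> \<in> space M" and d: "real m < real n * dist_mod1 (\<theta>hat n \<omega>) \<theta>"
    for n m \<omega>
  proof -
    have n0: "real n > 0" using n by simp
    obtain k \<sigma> where \<sigma>: "\<sigma> = 1 \<or> \<sigma> = -1" and k: "2 * k \<le> n"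
      and dk: "dist_mod1 (\<theta>hat n \<omega>) \<theta> \<le> (real k + 1) / real n"
      and sh: "\<forall>x. \<bar>g (x - (\<theta>hat n \<omega> - \<theta>)) - g (x - of_int (\<sigma> * int k) / real n)\<bar> \<le> L / real n"
      using round_shift_to_grid[OF lip less_imp_le[OF L] per n(1), of "\<theta>hat n \<omega>" \<theta>] by blast
    have "real n * dist_mod1 (\<theta>hat n \<omega>) \<theta> \<le> real k + 1"
      using dk n0 by (simp add: pos_le_divide_eq mult.commute)
    \<comment> \<open>Rounding gives only \<open>k + 1\<close> as a bound, but the strict inequality
      between integers still yields \<open>m \<le> k\<close>.\<close>
    then have mk: "m \<le> k" using d by linarith
    define R where "R i = real (rank_of (Y n \<omega>) n i) / real n" for i
    have R: "0 \<le> R i" "R i \<le> 1" for i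
    proof -
      have "rank_of (Y n \<omega>) n i \<le> card {1..n}" unfolding rank_of_def by (intro card_mono) auto
      then show "R i \<le> 1" using n0 by (simp add: R_def)
    qed (simp add: R_def)
    define b where "b i = g (real i / real n - of_int (\<sigma> * int k) / real n)" for i
    define h where "h i = g (real i / real n - (\<theta>hat n \<omega> - \<theta>))" for i
    have "(\<Sum>i = 1..n. R i * (g (real i / real n) - b i)) \<le> (\<Sum>i = 1..n. R i * (h i - b i))"
      using max[OF n(1) \<omega>] by (simp add: R_def h_def right_diff_distrib sum_subtractf)
    also have "\<dots> \<le> (\<Sum>i = 1..n. 1 * (L / real n))"
    proof (intro sum_mono)
      fix i
      have "R i * (h i - b i) \<le> R i * \<bar>h i - b i\<bar>" using R by (intro mult_left_mono) auto
      also have "\<dots> \<le> 1 * (L / real n)" unfolding h_def b_def using R sh by (intro mult_mono) auto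
      finally show "R i * (h i - b i) \<le> 1 * (L / real n)" .
    qed
    also have "\<dots> = L" using n0 by simp
    finally have "(\<Sum>i = 1..n. R i * (g (real i / real n) - b i)) / real n \<le> L / real n"
      using n0 by (intro divide_right_mono) auto
    then have "W n (\<sigma> * int k) \<omega> + C * (real k / real n)\<^sup>2 \<le> L / real n"
      using rank_objective_decomposition[of Z ?N g n \<omega> "\<sigma> * int k", OF ind N per]
        drift[OF n(2) order_trans[OF m(1) mk] k \<sigma>]
      unfolding W_def F_def R_def Y_def b_def by linarith
    moreover have "C * (real m / real n)\<^sup>2 \<le> C * (real k / real n)\<^sup>2"
      using C mk n0 by (intro mult_left_mono power_mono divide_right_mono) auto
    \<comment> \<open>The rounding error \<open>L/n\<close> is at most half of the drift, by the
      second condition on \<open>m\<close>; the noise must cancel the other half.\<close>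
    ultimately have "C / 2 * (real k / real n)\<^sup>2 \<le> - W n (\<sigma> * int k) \<omega>"
      using m(2) by simp
    then have "(C / 2 * (real k / real n)\<^sup>2)\<^sup>2 \<le> (- W n (\<sigma> * int k) \<omega>)\<^sup>2"
      using C by (intro power_mono) auto
    also have "\<dots> = (W n (\<sigma> * int k) \<omega>)\<^sup>2" by simp
    also have "\<dots> \<le> 4 * real k ^ 3 * Q n m \<sigma> \<omega>"
      unfolding Q_def
      by (rule weighted_increment_bound[of "\<lambda>l. W n (\<sigma> * int l) \<omega>"])
        (use m mk k in \<open>auto simp: W_def rank_noise_def\<close>)
    also have "(C / 2 * (real k / real n)\<^sup>2)\<^sup>2 = 4 * real k ^ 3 * (C\<^sup>2 * real k / (16 * real n ^ 4))"
      by (simp add: power_mult_distrib power_divide eval_nat_numeral)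
    finally have "C\<^sup>2 * real k / (16 * real n ^ 4) \<le> Q n m \<sigma> \<omega>"
      using m(1) mk by (subst (asm) mult_le_cancel_left_pos) auto
    moreover have "C\<^sup>2 * real m / (16 * real n ^ 4) \<le> C\<^sup>2 * real k / (16 * real n ^ 4)"
      using mk by (intro divide_right_mono mult_left_mono) auto
    ultimately show ?thesis using \<sigma> by auto
  qed
  \<comment> \<open>The summands serve in turn to make \<open>m \<ge> 1\<close>, to settle the
    finitely many small \<open>n\<close>, to let half of the drift absorb the rounding error, and to
    push the final probability below \<open>eps\<close>. The summand 1 also makes the last
    inequality strict.\<close>
  define K where "K = 1 + sqrt (4 * L / \<epsilon>) + sqrt (8 * L / C) + sqrt (512 * L\<^sup>2 / (C\<^sup>2 * eps))"
  have nn: "0 \<le> sqrt (4 * L / \<epsilon>)" "0 \<le> sqrt (8 * L / C)" "0 \<le> sqrt (512 * L\<^sup>2 / (C\<^sup>2 * eps))"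
    using L \<epsilon>(1) C eps by auto
  have K1: "K \<ge> 1" and K2: "K \<ge> sqrt (4 * L / \<epsilon>)" and "K \<ge> sqrt (8 * L / C)"
    and "K > sqrt (512 * L\<^sup>2 / (C\<^sup>2 * eps))"
    unfolding K_def using nn by linarith+
  then have K3: "8 * L / C \<le> K\<^sup>2" and K4: "512 * L\<^sup>2 / (C\<^sup>2 * eps) < K\<^sup>2"
    by (auto intro: sqrt_le_D) (meson leI linorder_not_less real_le_rsqrt)
  have "prob {\<omega> \<in> space M. sqrt (real n) * dist_mod1 (\<theta>hat n \<omega>) \<theta> > K} < eps" if n: "n \<ge> 1" for n
  proof (cases "real n \<ge> 4 * L / \<epsilon>")
    case False
    have "sqrt (real n) * dist_mod1 (\<theta>hat n \<omega>) \<theta> \<le> K" for \<omega>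
    proof -
      have "dist_mod1 (\<theta>hat n \<omega>) \<theta> \<le> 1"
        using dist_mod1_le[of "\<theta>hat n \<omega>" \<theta> "\<lfloor>\<theta>hat n \<omega> - \<theta>\<rfloor>"] by linarith
      then have "sqrt (real n) * dist_mod1 (\<theta>hat n \<omega>) \<theta> \<le> sqrt (real n)" by (simp add: mult_left_le)
      also have "\<dots> \<le> sqrt (4 * L / \<epsilon>)" using False by simp
      finally show ?thesis using K2 by simp
    qed
    then have "{\<omega> \<in> space M. sqrt (real n) * dist_mod1 (\<theta>hat n \<omega>) \<theta> > K} = {}" by (auto simp: not_less)
    then show ?thesis using eps by (simp only: measure_empty)
  next
    case True
    have n0: "real n > 0" "sqrt (real n) \<ge> 1" using n by auto
    \<comment> \<open>Rounding down loses at most a factor 2, since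
      \<open>m \<ge> 1\<close>.\<close>
    define m where "m = nat \<lfloor>K * sqrt (real n)\<rfloor>"
    have Kn: "1 \<le> K * sqrt (real n)" using mult_mono[OF K1 n0(2)] K1 by simp
    then have "int m = \<lfloor>K * sqrt (real n)\<rfloor>" by (simp add: m_def)
    then have m: "1 \<le> m" "real m \<le> K * sqrt (real n)" "K * sqrt (real n) < real m + 1"
      using Kn by linarith+
    have "real m \<ge> 1" using m(1) by simp
    then have "K * sqrt (real n) / 2 \<le> real m" using m(3) by linarith
    then have "(K * sqrt (real n) / 2)\<^sup>2 \<le> (real m)\<^sup>2" using Kn by (intro power_mono) auto
    then have m2: "K\<^sup>2 * real n / 4 \<le> (real m)\<^sup>2" by (simp add: power_mult_distrib power_divide)
    have "8 * L \<le> C * K\<^sup>2" using K3 C by (simp add: field_simps)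
    then have "8 * L * real n \<le> C * K\<^sup>2 * real n" by (intro mult_right_mono) auto
    also have "\<dots> = 4 * (C * (K\<^sup>2 * real n / 4))" by simp
    also have "\<dots> \<le> 4 * (C * (real m)\<^sup>2)" using C m2 by (intro mult_left_mono) auto
    finally have m3: "2 * L / real n \<le> C * (real m / real n)\<^sup>2"
      using n0 by (simp add: power_divide field_simps power2_eq_square)
    define t where "t = C\<^sup>2 * real m / (16 * real n ^ 4)"
    have t: "t > 0" using C m n0 by (simp add: t_def)
    define A where "A \<sigma> = {\<omega> \<in> space M. t \<le> Q n m \<sigma> \<omega>}" for \<sigma>
    have A: "A \<sigma> \<in> events" "prob (A \<sigma>) \<le> 4 * L\<^sup>2 / (real n ^ 3 * real m * t)" if "\<sigma> = 1 \<or> \<sigma> = -1" for \<sigma>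
      unfolding A_def Q_def W_def
      using rank_noise_weighted_tail[OF ind lip n that m(1) t] by blast+
    have "{\<omega> \<in> space M. sqrt (real n) * dist_mod1 (\<theta>hat n \<omega>) \<theta> > K} \<subseteq> A 1 \<union> A (-1)"
    proof
      fix \<omega> assume "\<omega> \<in> {\<omega> \<in> space M. sqrt (real n) * dist_mod1 (\<theta>hat n \<omega>) \<theta> > K}"
      then have \<omega>: "\<omega> \<in> space M" and "K < sqrt (real n) * dist_mod1 (\<theta>hat n \<omega>) \<theta>" by auto
      then have "K * sqrt (real n) < sqrt (real n) * dist_mod1 (\<theta>hat n \<omega>) \<theta> * sqrt (real n)"
        using n0 by (intro mult_strict_right_mono) auto
      also have "\<dots> = real n * dist_mod1 (\<theta>hat n \<omega>) \<theta>"
        by (simp add: mult.commute mult.left_commute flip: mult.assoc)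
      finally have "real m < real n * dist_mod1 (\<theta>hat n \<omega>) \<theta>" using m(2) by simp
      from large[OF n True m(1) m3 \<omega> this] show "\<omega> \<in> A 1 \<union> A (-1)"
        using \<omega> by (auto simp: A_def t_def)
    qed
    then have "prob {\<omega> \<in> space M. sqrt (real n) * dist_mod1 (\<theta>hat n \<omega>) \<theta> > K} \<le> prob (A 1 \<union> A (-1))"
      using A(1) by (intro finite_measure_mono) auto
    also have "\<dots> \<le> prob (A 1) + prob (A (-1))" using A(1) by (intro measure_Un_le) auto
    \<comment> \<open>One tail bound for each direction. With \<open>t\<close> proportional to
      \<open>m / n^4\<close>, the product \<open>m * t\<close> contains \<open>m^2\<close>, which is
      at least \<open>K^2 * n / 4\<close>, and \<open>n\<close> cancels.\<close>
    also have "\<dots> \<le> 2 * (4 * L\<^sup>2 / (real n ^ 3 * real m * t))" unfolding mult_2 by (intro add_mono A(2)) auto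
    also have "\<dots> = 128 * L\<^sup>2 * real n / (C\<^sup>2 * (real m)\<^sup>2)"
      using n0 m C by (simp add: t_def eval_nat_numeral field_simps)
    also have "\<dots> \<le> 128 * L\<^sup>2 * real n / (C\<^sup>2 * (K\<^sup>2 * real n / 4))"
      using n0 m2 C K1 L m(1) by (intro divide_left_mono mult_left_mono mult_pos_pos) auto
    also have "\<dots> = 512 * L\<^sup>2 / (C\<^sup>2 * K\<^sup>2)" using n0 by simp
    also have "\<dots> < eps"
      using K4 C eps K1 by (simp add: field_simps)
    finally show ?thesis .
  qed
  then show ?thesis by blast
qed

theorem theorem2:
  fixes f :: "real \<Rightarrow> real" and \<phi> :: "real \<Rightarrow> real" and \<theta>s :: real
    and M :: "'a measure" and Z :: "nat \<Rightarrow> 'a \<Rightarrow> real"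
    and \<theta>hat :: "nat \<Rightarrow> 'a \<Rightarrow> real"
  assumes lip: "\<exists>L. L-lipschitz_on UNIV f"
    and per: "\<forall>x. f (x + 1) = f x"
    and exact_per: "\<forall>\<theta> \<theta>'. \<theta> - \<theta>' \<notin> \<int> \<longrightarrow>
                        emeasure lborel {x. f (x - \<theta>) \<noteq> f (x - \<theta>')} > 0"
    and P: "prob_space M"
    and indep: "prob_space.indep_vars M (\<lambda>_. borel) Z {1..}"
    and phi_meas: "\<phi> \<in> borel_measurable borel"
    and phi_nonneg: "\<forall>z. \<phi> z \<ge> 0"
    and phi_even: "\<forall>z. \<phi> (- z) = \<phi> z"
    and dens: "\<forall>i\<ge>1. distributed M lborel (Z i) (\<lambda>z. ennreal (\<phi> z))"
    and uniq_max: "\<forall>\<theta>. \<theta> - \<theta>s \<notin> \<int> \<longrightarrow> Mpop f \<phi> \<theta>s \<theta> < Mpop f \<phi> \<theta>s \<theta>s"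
    and hat_meas: "\<forall>n. \<theta>hat n \<in> borel_measurable M"
    and hat_max: "\<forall>n\<ge>1. \<forall>\<omega>\<in>space M. \<forall>\<theta>.
          Mhat f n (\<lambda>i. f (real i / real n - \<theta>s) + Z i \<omega>) \<theta>
            \<le> Mhat f n (\<lambda>i. f (real i / real n - \<theta>s) + Z i \<omega>) (\<theta>hat n \<omega>)"
  shows "\<forall>\<epsilon>>0. \<exists>K. \<forall>n\<ge>1.
           measure M {\<omega> \<in> space M. sqrt (real n) * dist_mod1 (\<theta>hat n \<omega>) \<theta>s > K} < \<epsilon>"
proof (intro allI impI)
  fix \<epsilon> :: real assume \<epsilon>: "\<epsilon> > 0"
  interpret prob_space M by (rule P)
  obtain L0 where L0: "L0-lipschitz_on UNIV f" using lip by blast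
  \<comment> \<open>Adding 1 makes the constant positive even for constant \<open>f\<close>, as the
    divisions by \<open>L\<close> require.\<close>
  define L where "L = L0 + 1"
  define g where "g x = f (x - \<theta>s)" for x
  have "L-lipschitz_on UNIV f" using L0 by (rule lipschitz_on_mono) (auto simp: L_def)
  then have lipg: "\<bar>g x - g y\<bar> \<le> L * \<bar>x - y\<bar>" for x y
    using lipschitz_onD[of L UNIV f "x - \<theta>s" "y - \<theta>s"] by (simp add: g_def dist_real_def)
  have L: "L > 0" using lipschitz_on_nonneg[OF L0] by (simp add: L_def)
  have perg: "g (x + 1) = g x" for x using per[rule_format, of "x - \<theta>s"] by (simp add: g_def algebra_simps)
  have exactg: "\<exists>x. g x \<noteq> g (x - t)" if "1/4 \<le> t" "t \<le> 1/2" for t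
  proof -
    \<comment> \<open>A shift between 1/4 and 1/2 is not an integer, so exact periodicity gives a
      set of positive measure, hence a point where the shifted functions differ.\<close>
    have "(\<theta>s + t) - \<theta>s \<notin> \<int>"
    proof
      assume "(\<theta>s + t) - \<theta>s \<in> \<int>"
      then obtain z :: int where "t = of_int z" by (auto elim: Ints_cases)
      then have "0 < real_of_int z" "real_of_int z < 1" using that by linarith+
      then show False by simp
    qed
    then have "emeasure lborel {x. f (x - (\<theta>s + t)) \<noteq> f (x - \<theta>s)} > 0" using exact_per by blast
    then have "{x. f (x - (\<theta>s + t)) \<noteq> f (x - \<theta>s)} \<noteq> {}" by (metis emeasure_empty less_irrefl)
    then obtain x where "f (x - (\<theta>s + t)) \<noteq> f (x - \<theta>s)" by blast
    then have "g x \<noteq> g (x - t)" by (simp add: g_def algebra_simps)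
    then show ?thesis ..
  qed
  have distrZ: "distr M borel (Z i) = density lborel (\<lambda>z. ennreal (\<phi> z))" if "i \<ge> 1" for i
  proof -
    have "distr M borel (Z i) = distr M lborel (Z i)" by (rule distr_cong) auto
    then show ?thesis using dens that by (simp add: distributed_def)
  qed
  have maxg: "(\<Sum>i = 1..n. real (rank_of (\<lambda>i. g (real i / real n) + Z i \<omega>) n i) / real n * g (real i / real n))
      \<le> (\<Sum>i = 1..n. real (rank_of (\<lambda>i. g (real i / real n) + Z i \<omega>) n i) / real n
        * g (real i / real n - (\<theta>hat n \<omega> - \<theta>s)))" if "n \<ge> 1" "\<omega> \<in> space M" for n \<omega>
  proof -
    \<comment> \<open>The maximizer is compared with the true shift alone.\<close>
    have "Mhat f n (\<lambda>i. g (real i / real n) + Z i \<omega>) \<theta>s \<le> Mhat f n (\<lambda>i. g (real i / real n) + Z i \<omega>) (\<theta>hat n \<omega>)"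
      unfolding g_def using hat_max that by blast
    then show ?thesis using that(1) unfolding Mhat_def
      by (subst (asm) mult_le_cancel_left_pos) (auto simp: g_def)
  qed
  show "\<exists>K. \<forall>n\<ge>1. measure M {\<omega> \<in> space M. sqrt (real n) * dist_mod1 (\<theta>hat n \<omega>) \<theta>s > K} < \<epsilon>"
    by (rule rank_estimator_sqrt_consistent[OF indep distrZ phi_meas lipg L perg exactg maxg \<epsilon>])
qed

end
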